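(* There exist a constant $C>0$ and polynomials $P_1$ (in two variables), $P_2,P_3$ (each taking values $\ge1$ on positive integers) such that the following holds. Let $m\ge1$ and $k\ge3$ be integers, $\beta\in(0,1/4)$, let $n$ be an integer with $n\ge P_1(m,k)\exp(C/\beta)$, and let $b\in\big((kn\beta,\,kn(1/2-\beta))\cap\mathbb{Z}\big)^m$. Let $c\in\mathbb{R}^n$ have i.i.d. exponential entries (density $e^{-x}$ for $x\ge0$) and let $A\in\mathbb{R}^{m\times n}$, independent of $c$, have independent entries uniformly distributed in $\{1,\dots,k\}$. Then $$\Pr\left(\mathsf{IPGAP}(A,b,c)\ge\frac{\exp(C/\beta)\,P_2(m)(\log n)^2}{n}\right)\le n^{-P_3(m)}.$$
   Context: For $A\in\mathbb{R}^{m\times n}$, $b\in\mathbb{R}^m$, $c\in\mathbb{R}^n$ let $\mathrm{val}_{\mathsf{IP}}(A,b,c)=\max\{c^{\mathsf T}x: Ax\le b,\ x\in\{0,1\}^n\}$, let $\mathrm{val}_{\mathsf{LP}}(A,b,c)=\max\{c^{\mathsf T}x: Ax\le b,\ x\in[0,1]^n\}$, and let $\mathsf{IPGAP}(A,b,c)=\mathrm{val}_{\mathsf{LP}}(A,b,c)-\mathrm{val}_{\mathsf{IP}}(A,b,c)$. *)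

theory Defs
  imports "HOL-Probability.Probability" "HOL-Computational_Algebra.Polynomial"
begin

text \<open>
  Since the dimensions \<open>m\<close> and \<open>n\<close> are quantified inside the statement, a vector in \<open>X\<^sup>n\<close> is an
  element of \<open>{..<n} \<rightarrow>\<^sub>E X\<close>, and an \<open>m \<times> n\<close> matrix is a function of two indices of which only the
  entries \<open>A i j\<close> with \<open>i < m\<close> and \<open>j < n\<close> are used.
\<close>

definition feasible ::
  "nat \<Rightarrow> nat \<Rightarrow> (nat \<Rightarrow> nat \<Rightarrow> real) \<Rightarrow> (nat \<Rightarrow> real) \<Rightarrow> real set \<Rightarrow> (nat \<Rightarrow> real) set"
  where "feasible m n A b X = {x \<in> {..<n} \<rightarrow>\<^sub>E X. \<forall>i<m. (\<Sum>j<n. A i j * x j) \<le> b i}"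

text \<open>
  The maxima are written as suprema; lemmas \<open>val_LP_attained\<close> and \<open>val_IP_attained\<close> show that they
  are attained whenever the program is feasible. With \<open>A \<ge> 0\<close> and \<open>b \<ge> 0\<close> this is always the case,
  because of the point \<open>x = 0\<close>.
\<close>

definition val_IP ::
  "nat \<Rightarrow> nat \<Rightarrow> (nat \<Rightarrow> nat \<Rightarrow> real) \<Rightarrow> (nat \<Rightarrow> real) \<Rightarrow> (nat \<Rightarrow> real) \<Rightarrow> real"
  where "val_IP m n A b c = (SUP x \<in> feasible m n A b {0, 1}. \<Sum>j<n. c j * x j)"

definition val_LP ::
  "nat \<Rightarrow> nat \<Rightarrow> (nat \<Rightarrow> nat \<Rightarrow> real) \<Rightarrow> (nat \<Rightarrow> real) \<Rightarrow> (nat \<Rightarrow> real) \<Rightarrow> real"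
  where "val_LP m n A b c = (SUP x \<in> feasible m n A b {0..1}. \<Sum>j<n. c j * x j)"

definition IPGAP ::
  "nat \<Rightarrow> nat \<Rightarrow> (nat \<Rightarrow> nat \<Rightarrow> real) \<Rightarrow> (nat \<Rightarrow> real) \<Rightarrow> (nat \<Rightarrow> real) \<Rightarrow> real"
  where "IPGAP m n A b c = val_LP m n A b c - val_IP m n A b c"

text \<open>
  The joint law of \<open>(A, c)\<close>: all entries are independent, those of \<open>A\<close> (indexed by pairs, with
  natural number values) uniform on \<open>{1..k}\<close> and those of \<open>c\<close> exponential with rate 1.
\<close>

definition instance_law :: "nat \<Rightarrow> nat \<Rightarrow> nat \<Rightarrow> ((nat \<times> nat \<Rightarrow> nat) \<times> (nat \<Rightarrow> real)) measure"
  where "instance_law m n k =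
    (\<Pi>\<^sub>M ij\<in>{..<m} \<times> {..<n}. measure_pmf (pmf_of_set {1..k}))
      \<Otimes>\<^sub>M (\<Pi>\<^sub>M j\<in>{..<n}. density lborel (exponential_density 1))"

text \<open>
  A polynomial in two variables is a polynomial whose coefficients are polynomials in the first
  variable; \<open>poly2 P x y\<close> is its value at \<open>(x, y)\<close>.
\<close>

definition poly2 :: "'a::comm_semiring_0 poly poly \<Rightarrow> 'a \<Rightarrow> 'a \<Rightarrow> 'a"
  where "poly2 P x y = poly (poly P [:y:]) x"

lemma poly2_monom: "poly2 (monom (monom a i) j) x y = (a::'a::comm_semiring_1) * x ^ i * y ^ j"
  by (simp add: poly2_def poly_monom poly_const_pow mult_ac)

lemma poly2_add: "poly2 (P + Q) x y = poly2 P x y + poly2 Q x y"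
  by (simp add: poly2_def)


subsection \<open>The maxima are attained\<close>

lemma continuous_on_linear_form:
  "continuous_on S (\<lambda>x::nat \<Rightarrow> real. \<Sum>j<n. c j * x j)"
  by (intro continuous_intros continuous_on_subset[OF continuous_on_product_coordinates]) auto

lemma compact_feasible:
  assumes "compact X"
  shows "compact (feasible m n A b X)"
proof -
  have "compact (PiE UNIV (\<lambda>j. if j < n then X else {undefined}))"
    using assms
      compactin_PiE[of "\<lambda>_. euclidean :: real topology" UNIV
        "\<lambda>j. if j < n then X else {undefined}"]
    by (simp add: euclidean_product_topology)
  also have "PiE UNIV (\<lambda>j. if j < n then X else {undefined}) = {..<n} \<rightarrow>\<^sub>E X"
    by (auto simp: PiE_def Pi_def extensional_def split: if_splits)
  finally have "compact ({..<n} \<rightarrow>\<^sub>E X)" .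
  moreover have "closed {x::nat \<Rightarrow> real. \<forall>i<m. (\<Sum>j<n. A i j * x j) \<le> b i}"
    by (intro closed_Collect_all closed_Collect_imp open_Collect_const closed_Collect_le
        continuous_on_linear_form continuous_on_const)
  ultimately have "compact (({..<n} \<rightarrow>\<^sub>E X) \<inter> {x. \<forall>i<m. (\<Sum>j<n. A i j * x j) \<le> b i})"
    by (rule compact_Int_closed)
  also have "({..<n} \<rightarrow>\<^sub>E X) \<inter> {x. \<forall>i<m. (\<Sum>j<n. A i j * x j) \<le> b i} = feasible m n A b X"
    by (auto simp: feasible_def)
  finally show ?thesis .
qed

lemma Sup_linear_form_attained:
  assumes "compact X" "feasible m n A b X \<noteq> {}"
  obtains x where "x \<in> feasible m n A b X"
    "(SUP x \<in> feasible m n A b X. \<Sum>j<n. c j * x j) = (\<Sum>j<n. c j * x j)"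
    "\<forall>y\<in>feasible m n A b X. (\<Sum>j<n. c j * y j) \<le> (\<Sum>j<n. c j * x j)"
proof -
  obtain x where x: "x \<in> feasible m n A b X"
    "\<forall>y\<in>feasible m n A b X. (\<Sum>j<n. c j * y j) \<le> (\<Sum>j<n. c j * x j)"
    using continuous_attains_sup[OF compact_feasible[OF assms(1)] assms(2) continuous_on_linear_form]
    by blast
  moreover have "(SUP x \<in> feasible m n A b X. \<Sum>j<n. c j * x j) = (\<Sum>j<n. c j * x j)"
    using x by (intro cSup_eq_maximum) auto
  ultimately show thesis using that by blast
qed

lemma val_LP_attained:
  assumes "feasible m n A b {0..1} \<noteq> {}"
  obtains x where "x \<in> feasible m n A b {0..1}" "val_LP m n A b c = (\<Sum>j<n. c j * x j)"
    "\<forall>y\<in>feasible m n A b {0..1}. (\<Sum>j<n. c j * y j) \<le> val_LP m n A b c"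
proof -
  obtain x where "x \<in> feasible m n A b {0..1}"
    "(SUP x \<in> feasible m n A b {0..1}. \<Sum>j<n. c j * x j) = (\<Sum>j<n. c j * x j)"
    "\<forall>y\<in>feasible m n A b {0..1}. (\<Sum>j<n. c j * y j) \<le> (\<Sum>j<n. c j * x j)"
    by (rule Sup_linear_form_attained[OF compact_Icc assms, where c = c])
  then show thesis
    using that[of x] by (simp add: val_LP_def)
qed

lemma val_IP_attained:
  assumes "feasible m n A b {0, 1} \<noteq> {}"
  obtains x where "x \<in> feasible m n A b {0, 1}" "val_IP m n A b c = (\<Sum>j<n. c j * x j)"
    "\<forall>y\<in>feasible m n A b {0, 1}. (\<Sum>j<n. c j * y j) \<le> val_IP m n A b c"
proof -
  have compact: "compact {0, 1::real}" by (intro finite_imp_compact) auto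
  obtain x where "x \<in> feasible m n A b {0, 1}"
    "(SUP x \<in> feasible m n A b {0, 1}. \<Sum>j<n. c j * x j) = (\<Sum>j<n. c j * x j)"
    "\<forall>y\<in>feasible m n A b {0, 1}. (\<Sum>j<n. c j * y j) \<le> (\<Sum>j<n. c j * x j)"
    by (rule Sup_linear_form_attained[OF compact assms, where c = c])
  then show thesis
    using that[of x] by (simp add: val_IP_def)
qed


subsection \<open>The probability space, and measurability of the gap\<close>

lemma prob_space_instance_law: "prob_space (instance_law m n k)"
proof -
  have "prob_space (density lborel (exponential_density 1))"
    by (rule prob_space_exponential_density) simp
  then show ?thesis
    unfolding instance_law_def
    by (intro prob_space_pair prob_space_PiM measure_pmf.prob_space_axioms)
qed

lemma countable_dense_subset:
  fixes S :: "'a::second_countable_topology set"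
  obtains T where "countable T" "T \<subseteq> S" "\<And>U. open U \<Longrightarrow> U \<inter> S \<noteq> {} \<Longrightarrow> U \<inter> T \<noteq> {}"
proof -
  obtain B :: "'a set set" where B: "countable B" "topological_basis B"
    using ex_countable_basis by blast
  define T where "T = (\<lambda>V. SOME x. x \<in> V \<inter> S) ` {V \<in> B. V \<inter> S \<noteq> {}}"
  have T: "(SOME x. x \<in> V \<inter> S) \<in> V \<inter> S" if "V \<inter> S \<noteq> {}" for V
    using that someI_ex[of "\<lambda>x. x \<in> V \<inter> S"] by blast
  show thesis
  proof
    show "countable T" using B(1) by (simp add: T_def)
    show "T \<subseteq> S" using T by (auto simp: T_def)
  next
    fix U :: "'a set" assume "open U" "U \<inter> S \<noteq> {}"
    then obtain x V where x: "x \<in> S" "x \<in> V" "V \<in> B" "V \<subseteq> U"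
      using topological_basisE[OF B(2)] by (metis disjoint_iff)
    then have "V \<inter> S \<noteq> {}" by blast
    with x T[of V] show "U \<inter> T \<noteq> {}" unfolding T_def by blast
  qed
qed

lemma borel_measurable_Sup_linear_form:
  assumes "compact X"
  shows "(\<lambda>c. SUP x \<in> feasible m n A b X. \<Sum>j<n. c j * x j)
    \<in> borel_measurable (\<Pi>\<^sub>M j\<in>{..<n}. density lborel (exponential_density 1))"
    (is "_ \<in> borel_measurable ?M")
proof (cases "feasible m n A b X = {}")
  case False
  define S where "S = feasible m n A b X"
  obtain T where T: "countable T" "T \<subseteq> S" "\<And>U. open U \<Longrightarrow> U \<inter> S \<noteq> {} \<Longrightarrow> U \<inter> T \<noteq> {}"
    using countable_dense_subset by blast
  have "T \<noteq> {}" using T(3)[of UNIV] False by (auto simp: S_def)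
  have bdd: "bdd_above ((\<lambda>x. \<Sum>j<n. c j * x j) ` S)" for c :: "nat \<Rightarrow> real"
    unfolding S_def
    by (intro bounded_imp_bdd_above compact_imp_bounded compact_continuous_image
        continuous_on_linear_form compact_feasible assms)
  have bddT: "bdd_above ((\<lambda>x. \<Sum>j<n. c j * x j) ` T)" for c :: "nat \<Rightarrow> real"
    using T(2) by (intro bdd_above_mono[OF bdd[of c]] image_mono)
  have eq: "(SUP x \<in> S. \<Sum>j<n. c j * x j) = (SUP x \<in> T. \<Sum>j<n. c j * x j)"
    for c :: "nat \<Rightarrow> real"
  proof (rule antisym)
    show "(SUP x \<in> S. \<Sum>j<n. c j * x j) \<le> (SUP x \<in> T. \<Sum>j<n. c j * x j)"
    proof (rule cSUP_least)
      show "S \<noteq> {}" using False by (simp add: S_def)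
      fix x assume "x \<in> S"
      show "(\<Sum>j<n. c j * x j) \<le> (SUP x \<in> T. \<Sum>j<n. c j * x j)"
      proof (rule ccontr)
        let ?U = "{y. (SUP x \<in> T. \<Sum>j<n. c j * x j) < (\<Sum>j<n. c j * y j)}"
        assume "\<not> ?thesis"
        then have "x \<in> ?U \<inter> S" using \<open>x \<in> S\<close> by (simp add: not_le)
        then have "?U \<inter> S \<noteq> {}" by blast
        moreover have "open ?U"
          by (intro open_Collect_less continuous_on_linear_form continuous_on_const)
        ultimately obtain y where "y \<in> T" "y \<in> ?U" using T(3) by blast
        with cSUP_upper[OF _ bddT, of y c] show False by auto
      qed
    qed
    show "(SUP x \<in> T. \<Sum>j<n. c j * x j) \<le> (SUP x \<in> S. \<Sum>j<n. c j * x j)"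
      by (intro cSUP_subset_mono bdd T(2) \<open>T \<noteq> {}\<close>) auto
  qed
  have "(\<lambda>c. SUP x \<in> T. \<Sum>j<n. c j * x j) \<in> borel_measurable ?M"
  proof (rule borel_measurable_cSUP[OF T(1) _ bddT])
    fix x
    have "(\<lambda>c. c j) \<in> borel_measurable ?M" if "j < n" for j
      using measurable_component_singleton[of j "{..<n}" "\<lambda>_. density lborel (exponential_density 1)"]
        that by (simp cong: measurable_cong_sets)
    then show "(\<lambda>c. \<Sum>j<n. c j * x j) \<in> borel_measurable ?M"
      by (intro borel_measurable_sum borel_measurable_times) auto
  qed
  then show ?thesis unfolding eq[symmetric] S_def .
qed simp

lemma IPGAP_measurable:
  "(\<lambda>(A, c). IPGAP m n (\<lambda>i j. real (A (i, j))) b c) \<in> borel_measurable (instance_law m n k)"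
proof -
  let ?I = "{..<m} \<times> {..<n}"
  let ?N = "\<Pi>\<^sub>M j\<in>{..<n}. density lborel (exponential_density 1)"
  have "sets (\<Pi>\<^sub>M ij\<in>?I. measure_pmf (pmf_of_set {1..k}))
      = sets (\<Pi>\<^sub>M ij\<in>?I. count_space (UNIV :: nat set))"
    by (intro sets_PiM_cong) auto
  also have "\<dots> = sets (count_space (?I \<rightarrow>\<^sub>E (UNIV :: nat set)))"
    by (subst count_space_PiM_finite) auto
  finally have sets: "sets (instance_law m n k)
      = sets (count_space (?I \<rightarrow>\<^sub>E (UNIV :: nat set)) \<Otimes>\<^sub>M ?N)"
    unfolding instance_law_def by (intro sets_pair_measure_cong refl)
  have "(\<lambda>c. IPGAP m n A b c) \<in> borel_measurable ?N" for A
    unfolding IPGAP_def val_LP_def val_IP_def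
    by (intro borel_measurable_diff borel_measurable_Sup_linear_form compact_Icc
        finite_imp_compact) auto
  then have "(\<lambda>(A, c). IPGAP m n (\<lambda>i j. real (A (i, j))) b c)
      \<in> borel_measurable (count_space (?I \<rightarrow>\<^sub>E (UNIV :: nat set)) \<Otimes>\<^sub>M ?N)"
    by (intro measurable_pair_measure_countable1 countable_PiE) auto
  then show ?thesis
    using measurable_cong_sets[OF sets refl] by blast
qed

end

theory Submission
  imports Defs
begin

text \<open>
  Replace the term \<open>max 0 r\<close> of the dual objective \<open>b \<bullet> u + (\<Sum>j. max 0 (c\<^sub>j - u \<bullet> a\<^sub>j))\<close> by the piecewise
  linear function with slopes \<open>0\<close>, \<open>1/2\<close>, \<open>1\<close> and kinks at \<open>\<plusminus>\<delta>\<close>, where \<open>\<delta>\<close> is of order \<open>log n / n\<close>, and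
  minimise over a fine grid of vectors \<open>u\<close>. The slopes at the minimiser are a nearly optimal point
  \<open>x\<close> with \<open>x\<^sub>j = 1/2\<close> whenever the reduced cost of column \<open>j\<close> lies in the window \<open>[-\<delta>, \<delta>)\<close>, and with \<open>0/1\<close>
  entries elsewhere. Comparing with the neighbouring grid points shows that this \<open>x\<close> is feasible and
  nearly tight in the constraints with \<open>u\<^sub>i > 0\<close>. Rounding the window entries, i.e. choosing a subset of
  the window columns with an exactly prescribed sum near half the total, costs only \<open>O(\<delta>)\<close> per column.

  Such a subset exists by Fourier inversion modulo \<open>M\<close>: after centring, the number of subsets with a given
  sum is a sum over frequencies of products of cosines; frequencies near \<open>0\<close> contribute
  nonnegatively, frequency \<open>0\<close> contributes \<open>1\<close>, and all others are negligible as soon as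
  \<open>\<Sum>j. sin\<^sup>2(\<pi> \<theta> \<bullet> a\<^sub>j)\<close> over the window is of order \<open>m log n\<close>.

  For a fixed grid point \<open>u\<close> the columns are independent, so all requirements on the window are
  exponential-moment bounds, and the grid has only \<open>n\<^bsup>O(m)\<^esup>\<close> points: a union bound replaces any
  conditioning on the optimal basis.
\<close>

subsection \<open>Subset sums by Fourier inversion\<close>

text \<open>A geometric sum over \<open>M\<close>-th roots of unity. The modulus is odd and the
  index is shifted by \<open>H\<close>, so the frequencies lie symmetrically around 0 with absolute
  value below 1/2, and frequency 0 has index \<open>H\<close>.\<close>

lemma sum_cis_orthogonality:
  fixes t :: int and H :: nat
  defines "M \<equiv> 2 * H + 1"
  shows "(\<Sum>l<M. cis (2 * pi * ((real l - real H) / real M) * of_int t)) = (if int M dvd t then of_nat M else 0)"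
proof -
  define z where "z = cis (2 * pi * of_int t / real M)"
  have M: "M > 0" by (simp add: M_def)
  have "cis (2 * pi * ((real l - real H) / real M) * of_int t) = cis (- (2 * pi * real H * of_int t / real M)) * z ^ l" for l
    unfolding z_def Complex.DeMoivre cis_mult by (rule arg_cong[where f = cis]) (simp add: field_simps diff_divide_distrib)
  then have eq: "(\<Sum>l<M. cis (2 * pi * ((real l - real H) / real M) * of_int t)) = cis (- (2 * pi * real H * of_int t / real M)) * (\<Sum>l<M. z ^ l)"
    by (simp add: sum_distrib_left)
  have zM: "z ^ M = 1"
  proof -
    have "z ^ M = cis (2 * pi * of_int t)" unfolding z_def Complex.DeMoivre using M by simp
    then show ?thesis by simp
  qed
  show ?thesis
  proof (cases "int M dvd t")
    case True
    then obtain q where q: "t = int M * q" by blast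
    have "cis (2 * pi * ((real l - real H) / real M) * of_int t) = 1" for l
    proof -
      have "2 * pi * ((real l - real H) / real M) * of_int t = 2 * pi * of_int ((int l - int H) * q)"
        using M by (simp add: q field_simps)
      then show ?thesis by (simp only: cis_multiple_2pi Ints_of_int)
    qed
    then show ?thesis using True by simp
  next
    case False
    have "z \<noteq> 1"
    proof
      assume "z = 1"
      then have "exp (\<i> * of_real (2 * pi * of_int t / real M)) = 1" by (simp add: z_def cis_conv_exp)
      then obtain q :: int where "2 * pi * of_int t / real M = of_int (2 * q) * pi"
        by (auto simp: exp_eq_1)
      then have "of_int t = (of_int q * real M :: real)" using M by (simp add: field_simps)
      then have "t = q * int M" by (metis of_int_eq_iff of_int_mult of_int_of_nat_eq)
      with False show False by simp
    qed
    then have "(\<Sum>l<M. z ^ l) = 0" using geometric_sum[of z M] zM by simp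
    then show ?thesis using eq False by simp
  qed
qed

text \<open>The half-angle factorisation: a real amplitude times a phase. The phase
  \<open>x / 2\<close> is what later moves the origin to half of the total sum.\<close>

lemma one_plus_cis: "1 + cis x = 2 * of_real (cos (x / 2)) * cis (x / 2)"
proof (rule complex_eqI)
  show "Re (1 + cis x) = Re (2 * of_real (cos (x / 2)) * cis (x / 2))"
    using cos_double_cos[of "x/2"] by (simp add: power2_eq_square)
  show "Im (1 + cis x) = Im (2 * of_real (cos (x / 2)) * cis (x / 2))"
    using sin_double[of "x/2"] by simp
qed

lemma prod_one_plus:
  fixes f :: "'a \<Rightarrow> 'b::comm_semiring_1"
  assumes "finite W"
  shows "(\<Prod>j\<in>W. 1 + f j) = (\<Sum>T\<in>Pow W. \<Prod>j\<in>T. f j)"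
  unfolding add.commute[of 1] prod_add[OF assms] by simp

lemma Re_of_real_mult: "Re (of_real r * z) = r * Re z"
  by simp

lemma prod_cis: "finite S \<Longrightarrow> (\<Prod>j\<in>S. cis (f j)) = cis (\<Sum>j\<in>S. f j)"
  by (induction rule: finite_induct) (simp_all add: cis_mult)

text \<open>Up to the factor \<open>M ^ m / 2 ^ card W\<close>, the sum counts the subsets whose
  sums are congruent to \<open>t\<close> modulo \<open>M\<close>. By \<open>range\<close>,
  congruence means equality, so \<open>nohit\<close> makes the count 0.\<close>

lemma subset_sum_fourier:
  fixes a :: "nat \<Rightarrow> 'j \<Rightarrow> int" and t :: "nat \<Rightarrow> int" and H m :: nat and M :: nat
    and \<theta> :: "(nat \<Rightarrow> nat) \<Rightarrow> nat \<Rightarrow> real"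
  defines "M \<equiv> 2 * H + 1"
  defines "\<theta> \<equiv> (\<lambda>l i. (real (l i) - real H) / real M)"
  assumes fin: "finite W"
    and range: "\<And>T i. T \<subseteq> W \<Longrightarrow> i < m \<Longrightarrow> \<bar>(\<Sum>j\<in>T. a i j) - t i\<bar> < int M"
    and nohit: "\<And>T. T \<subseteq> W \<Longrightarrow> \<exists>i<m. (\<Sum>j\<in>T. a i j) \<noteq> t i"
  shows "(\<Sum>l\<in>{..<m} \<rightarrow>\<^sub>E {..<M}. (\<Prod>j\<in>W. cos (pi * (\<Sum>i<m. \<theta> l i * a i j))) *
            cos (2 * pi * (\<Sum>i<m. \<theta> l i * ((\<Sum>j\<in>W. a i j) / 2 - t i)))) = 0"
proof -
  let ?L = "{..<m} \<rightarrow>\<^sub>E {..<M}"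
  have hit: "(\<Sum>l\<in>?L. \<Prod>i<m. cis (2 * pi * \<theta> l i * of_int ((\<Sum>j\<in>T. a i j) - t i))) = 0" if TW: "T \<subseteq> W" for T
  proof -
    obtain i where i: "i < m" "(\<Sum>j\<in>T. a i j) \<noteq> t i" using nohit[OF TW] by blast
    have nd: "\<not> int M dvd ((\<Sum>j\<in>T. a i j) - t i)"
      using range[OF TW i(1)] i(2) by (metis abs_of_nat dvd_imp_le_int eq_iff_diff_eq_0 linorder_not_less)
    have "(\<Sum>l\<in>?L. \<Prod>i<m. cis (2 * pi * \<theta> l i * of_int ((\<Sum>j\<in>T. a i j) - t i)))
       = (\<Prod>i<m. \<Sum>l<M. cis (2 * pi * ((real l - real H) / real M) * of_int ((\<Sum>j\<in>T. a i j) - t i)))"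
      unfolding \<theta>_def by (subst prod_sum_PiE) auto
    also have "\<dots> = 0"
      using i(1) sum_cis_orthogonality[of H "(\<Sum>j\<in>T. a i j) - t i"] nd unfolding M_def
      by (intro prod_zero) auto
    finally show ?thesis .
  qed
  have expand: "(\<Prod>j\<in>W. 1 + cis (2 * pi * (\<Sum>i<m. \<theta> l i * a i j))) * cis (- (2 * pi * (\<Sum>i<m. \<theta> l i * t i)))
     = (\<Sum>T\<in>Pow W. \<Prod>i<m. cis (2 * pi * \<theta> l i * of_int ((\<Sum>j\<in>T. a i j) - t i)))" for l
  proof -
    have "(\<Prod>j\<in>T. cis (2 * pi * (\<Sum>i<m. \<theta> l i * a i j))) * cis (- (2 * pi * (\<Sum>i<m. \<theta> l i * t i)))
      = (\<Prod>i<m. cis (2 * pi * \<theta> l i * of_int ((\<Sum>j\<in>T. a i j) - t i)))" if "T \<in> Pow W" for T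
    proof -
      have "finite T" using that fin finite_subset by blast
      have "(\<Sum>j\<in>T. 2 * pi * (\<Sum>i<m. \<theta> l i * a i j)) = (\<Sum>i<m. 2 * pi * \<theta> l i * (\<Sum>j\<in>T. a i j))"
        unfolding sum_distrib_left of_int_sum by (subst sum.swap) (simp add: mult_ac)
      then have "(\<Sum>j\<in>T. 2 * pi * (\<Sum>i<m. \<theta> l i * a i j)) + (- (2 * pi * (\<Sum>i<m. \<theta> l i * t i)))
        = (\<Sum>i<m. 2 * pi * \<theta> l i * of_int ((\<Sum>j\<in>T. a i j) - t i))"
        by (simp only: of_int_diff right_diff_distrib sum_subtractf) (simp add: sum_distrib_left mult.assoc)
      then show ?thesis using \<open>finite T\<close> by (simp only: prod_cis cis_mult finite_lessThan)
    qed
    then show ?thesis using fin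
      by (simp add: prod_one_plus sum_distrib_right)
  qed
  \<comment> \<open>Each factor contributes half of its angle as a phase. Together with the phase of
    \<open>t\<close> these measure the deviation of \<open>t\<close> from half of the total, and
    only real amplitudes remain.\<close>
  have polar: "(\<Prod>j\<in>W. 1 + cis (2 * pi * (\<Sum>i<m. \<theta> l i * a i j))) * cis (- (2 * pi * (\<Sum>i<m. \<theta> l i * t i)))
     = of_real (2 ^ card W * (\<Prod>j\<in>W. cos (pi * (\<Sum>i<m. \<theta> l i * a i j)))) *
       cis (2 * pi * (\<Sum>i<m. \<theta> l i * ((\<Sum>j\<in>W. a i j) / 2 - t i)))" for l
  proof -
    have "(\<Sum>j\<in>W. pi * (\<Sum>i<m. \<theta> l i * a i j)) = (\<Sum>i<m. 2 * pi * \<theta> l i * ((\<Sum>j\<in>W. a i j) / 2))"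
      unfolding sum_distrib_left of_int_sum sum_divide_distrib by (subst sum.swap) (simp add: mult_ac)
    then have "(\<Sum>j\<in>W. pi * (\<Sum>i<m. \<theta> l i * a i j)) + (- (2 * pi * (\<Sum>i<m. \<theta> l i * t i)))
        = 2 * pi * (\<Sum>i<m. \<theta> l i * ((\<Sum>j\<in>W. a i j) / 2 - t i))"
      by (simp only: right_diff_distrib sum_subtractf) (simp add: sum_distrib_left mult.assoc)
    then have c: "cis (\<Sum>j\<in>W. pi * (\<Sum>i<m. \<theta> l i * a i j)) * cis (- (2 * pi * (\<Sum>i<m. \<theta> l i * t i))) =
        cis (2 * pi * (\<Sum>i<m. \<theta> l i * ((\<Sum>j\<in>W. a i j) / 2 - t i)))"
      by (simp only: cis_mult)
    have "(\<Prod>j\<in>W. 1 + cis (2 * pi * (\<Sum>i<m. \<theta> l i * a i j))) =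
      (\<Prod>j\<in>W. (of_real (2 * cos (pi * (\<Sum>i<m. \<theta> l i * a i j)))) * cis (pi * (\<Sum>i<m. \<theta> l i * a i j)))"
      by (intro prod.cong refl) (simp add: one_plus_cis)
    also have "\<dots> = of_real (2 ^ card W * (\<Prod>j\<in>W. cos (pi * (\<Sum>i<m. \<theta> l i * a i j)))) * cis (\<Sum>j\<in>W. pi * (\<Sum>i<m. \<theta> l i * a i j))"
      using fin by (simp only: prod.distrib of_real_prod[symmetric] prod_constant prod_cis)
    finally show ?thesis using c by (simp only: mult.assoc)
  qed
  have "(\<Sum>l\<in>?L. of_real (2 ^ card W * (\<Prod>j\<in>W. cos (pi * (\<Sum>i<m. \<theta> l i * a i j)))) *
       cis (2 * pi * (\<Sum>i<m. \<theta> l i * ((\<Sum>j\<in>W. a i j) / 2 - t i)))) = 0"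
    unfolding polar[symmetric] expand by (subst sum.swap) (intro sum.neutral ballI hit, simp)
  then have "Re (\<Sum>l\<in>?L. of_real (2 ^ card W * (\<Prod>j\<in>W. cos (pi * (\<Sum>i<m. \<theta> l i * a i j)))) *
       cis (2 * pi * (\<Sum>i<m. \<theta> l i * ((\<Sum>j\<in>W. a i j) / 2 - t i)))) = 0"
    by simp
  then have "2 ^ card W * (\<Sum>l\<in>?L. (\<Prod>j\<in>W. cos (pi * (\<Sum>i<m. \<theta> l i * a i j))) *
            cos (2 * pi * (\<Sum>i<m. \<theta> l i * ((\<Sum>j\<in>W. a i j) / 2 - t i)))) = (0::real)"
    unfolding Re_sum sum_distrib_left Re_of_real_mult cis.sel by (simp only: mult.assoc)
  then show ?thesis by simp
qed

section \<open>Cosine products and the existence of a subset with prescribed sums\<close>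

lemma abs_cos_le_exp: "\<bar>cos x\<bar> \<le> exp (- (sin x)\<^sup>2 / 2)" for x :: real
proof (rule power2_le_imp_le)
  have "\<bar>cos x\<bar>\<^sup>2 = 1 + - (sin x)\<^sup>2" by (simp add: cos_squared_eq)
  also have "\<dots> \<le> exp (- (sin x)\<^sup>2)" by (rule exp_ge_add_one_self)
  also have "\<dots> = (exp (- (sin x)\<^sup>2 / 2))\<^sup>2" by (simp add: power2_eq_square flip: exp_add)
  finally show "\<bar>cos x\<bar>\<^sup>2 \<le> (exp (- (sin x)\<^sup>2 / 2))\<^sup>2" .
qed simp

lemma abs_prod_cos_le_exp:
  fixes x :: "'a \<Rightarrow> real"
  assumes "finite W"
  shows "\<bar>\<Prod>j\<in>W. cos (x j)\<bar> \<le> exp (- (\<Sum>j\<in>W. (sin (x j))\<^sup>2) / 2)"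
proof -
  have "\<bar>\<Prod>j\<in>W. cos (x j)\<bar> \<le> (\<Prod>j\<in>W. exp (- (sin (x j))\<^sup>2 / 2))"
    unfolding abs_prod by (intro prod_mono conjI abs_cos_le_exp) simp
  also have "\<dots> = exp (- (\<Sum>j\<in>W. (sin (x j))\<^sup>2) / 2)"
    using assms by (simp add: sum_divide_distrib sum_negf flip: exp_sum)
  finally show ?thesis .
qed

text \<open>If nothing is hit, the Fourier sum vanishes. But frequency 0 contributes 1, frequencies
  with all coordinates at most \<rho> contribute nonnegatively, and each remaining one contributes
  at least \<open>- exp (- L / 2)\<close>. There are fewer than \<open>M ^ m\<close> of the latter,
  so the total is positive.\<close>

lemma subset_sum_hit:
  fixes a :: "nat \<Rightarrow> 'j \<Rightarrow> int" and t :: "nat \<Rightarrow> int" and H m M :: nat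
    and \<theta> :: "(nat \<Rightarrow> nat) \<Rightarrow> nat \<Rightarrow> real" and \<rho> D L k :: real
  defines "M \<equiv> 2 * H + 1"
  defines "\<theta> \<equiv> (\<lambda>l i. (real (l i) - real H) / real M)"
  assumes fin: "finite W"
    and range: "\<And>T i. T \<subseteq> W \<Longrightarrow> i < m \<Longrightarrow> \<bar>(\<Sum>j\<in>T. a i j) - t i\<bar> < int M"
    and a: "\<And>i j. i < m \<Longrightarrow> j \<in> W \<Longrightarrow> \<bar>a i j\<bar> \<le> k"
    and D: "\<And>i. i < m \<Longrightarrow> \<bar>(\<Sum>j\<in>W. a i j) / 2 - t i\<bar> \<le> D"
    and \<rho>: "0 \<le> \<rho>" "m * \<rho> * D \<le> 1/4" "m * \<rho> * k \<le> 1/2"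
    and far: "\<And>l i. l \<in> {..<m} \<rightarrow>\<^sub>E {..<M} \<Longrightarrow> i < m \<Longrightarrow> \<rho> < \<bar>\<theta> l i\<bar> \<Longrightarrow>
        L \<le> (\<Sum>j\<in>W. (sin (pi * (\<Sum>i<m. \<theta> l i * a i j)))\<^sup>2)"
    and L: "real M ^ m \<le> exp (L / 2)"
  obtains T where "T \<subseteq> W" "\<And>i. i < m \<Longrightarrow> (\<Sum>j\<in>T. a i j) = t i"
proof (rule ccontr)
  assume "\<not> thesis"
  then have nohit: "\<exists>i<m. (\<Sum>j\<in>T. a i j) \<noteq> t i" if "T \<subseteq> W" for T
    using that \<open>\<And>T. \<lbrakk>T \<subseteq> W; \<And>i. i < m \<Longrightarrow> (\<Sum>j\<in>T. a i j) = t i\<rbrakk> \<Longrightarrow> thesis\<close> by auto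
  let ?L = "{..<m} \<rightarrow>\<^sub>E {..<M}"
  define F where "F l = (\<Prod>j\<in>W. cos (pi * (\<Sum>i<m. \<theta> l i * a i j))) *
            cos (2 * pi * (\<Sum>i<m. \<theta> l i * ((\<Sum>j\<in>W. a i j) / 2 - t i)))" for l
  have zero: "(\<Sum>l\<in>?L. F l) = 0"
    unfolding F_def \<theta>_def M_def
    by (rule subset_sum_fourier[OF fin range[unfolded M_def] nohit]) auto
  define l0 where "l0 = restrict (\<lambda>_. H) {..<m}"
  have l0: "l0 \<in> ?L" by (auto simp: l0_def M_def)
  have F0: "F l0 = 1" by (simp add: F_def \<theta>_def l0_def)
  have finL: "finite ?L" by (intro finite_PiE) auto
  have lin: "\<bar>\<Sum>i<m. \<theta> l i * y i\<bar> \<le> m * \<rho> * Y"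
    if "\<forall>i<m. \<bar>\<theta> l i\<bar> \<le> \<rho>" "\<And>i. i < m \<Longrightarrow> \<bar>y i\<bar> \<le> Y" for l Y and y :: "nat \<Rightarrow> real"
  proof -
    have "\<bar>\<Sum>i<m. \<theta> l i * y i\<bar> \<le> (\<Sum>i<m. \<bar>\<theta> l i * y i\<bar>)" by (rule sum_abs)
    also have "\<dots> \<le> (\<Sum>i<m. \<rho> * Y)" unfolding abs_mult using that \<rho>(1)
      by (intro sum_mono mult_mono) auto
    finally show ?thesis by simp
  qed
  have cos_nonneg: "cos (pi * x) \<ge> 0" if "\<bar>x\<bar> \<le> 1/2" for x :: real
  proof (rule cos_ge_zero)
    show "- (pi / 2) \<le> pi * x" using mult_left_mono[of "-1/2" x pi] that by simp
    show "pi * x \<le> pi / 2" using mult_left_mono[of x "1/2" pi] that by simp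
  qed
  \<comment> \<open>The two bounds on \<rho> keep all cosine arguments within \<open>pi / 2\<close>:
    \<open>pi\<close> times the form in the columns needs 1/2, and \<open>2 * pi\<close> times the
    form in the deviation needs 1/4.\<close>
  have near: "0 \<le> F l" if "\<forall>i<m. \<bar>\<theta> l i\<bar> \<le> \<rho>" for l
  proof -
    have "\<bar>\<Sum>i<m. \<theta> l i * a i j\<bar> \<le> 1/2" if "j \<in> W" for j
      using lin[of l "\<lambda>i. real_of_int (a i j)" k] \<open>\<forall>i<m. \<bar>\<theta> l i\<bar> \<le> \<rho>\<close> a[OF _ that] \<rho>(3) by force
    moreover have "\<bar>2 * (\<Sum>i<m. \<theta> l i * ((\<Sum>j\<in>W. a i j) / 2 - t i))\<bar> \<le> 1/2"
      using lin[of l "\<lambda>i. (\<Sum>j\<in>W. a i j) / 2 - t i" D] that D \<rho>(2) by force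
    ultimately show ?thesis unfolding F_def
      using cos_nonneg[of "2 * (\<Sum>i<m. \<theta> l i * ((\<Sum>j\<in>W. a i j) / 2 - t i))"]
      by (intro mult_nonneg_nonneg prod_nonneg ballI cos_nonneg) (auto simp: mult_ac)
  qed
  have "- exp (- L / 2) \<le> F l" if "l \<in> ?L" for l
  proof (cases "\<forall>i<m. \<bar>\<theta> l i\<bar> \<le> \<rho>")
    case True
    then show ?thesis using near[OF True] exp_gt_zero[of "- L / 2"] by linarith
  next
    case False
    then have "L \<le> (\<Sum>j\<in>W. (sin (pi * (\<Sum>i<m. \<theta> l i * a i j)))\<^sup>2)"
      using far[OF that] by force
    then have "\<bar>\<Prod>j\<in>W. cos (pi * (\<Sum>i<m. \<theta> l i * a i j))\<bar> \<le> exp (- L / 2)"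
      using abs_prod_cos_le_exp[OF fin, of "\<lambda>j. pi * (\<Sum>i<m. \<theta> l i * a i j)"]
      by (elim order_trans) simp
    then have "\<bar>F l\<bar> \<le> exp (- L / 2) * 1" unfolding F_def abs_mult
      by (intro mult_mono) auto
    then show ?thesis by linarith
  qed
  then have "(\<Sum>l\<in>?L - {l0}. - exp (- L / 2)) \<le> (\<Sum>l\<in>?L - {l0}. F l)"
    by (intro sum_mono) auto
  also have "\<dots> = -1" using zero sum.remove[OF finL l0, of F] F0 by simp
  finally have "1 \<le> real (card (?L - {l0})) * exp (- L / 2)" by simp
  moreover have "card (?L - {l0}) = M ^ m - 1"
    using l0 finL by (simp add: card_Diff_singleton card_PiE)
  \<comment> \<open>Removing \<open>l0\<close> leaves \<open>M ^ m - 1\<close> terms, which makes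
    the comparison with \<open>exp (L / 2)\<close> strict.\<close>
  ultimately have "1 \<le> real (M ^ m - 1) * exp (- L / 2)" by (simp only:)
  also have "\<dots> = (real M ^ m - 1) * exp (- L / 2)" proof -
    have "1 \<le> M ^ m" by (simp add: M_def)
    then show ?thesis by (simp only: of_nat_diff of_nat_power of_nat_1)
  qed
  also have "\<dots> < exp (L / 2) * exp (- L / 2)" using L by (intro mult_strict_right_mono) auto
  also have "\<dots> = 1" by (simp flip: exp_add)
  finally show False by simp
qed

section \<open>Squared sines along an arithmetic progression\<close>

lemma sin_pi_ge: 
  assumes "0 \<le> y" "y \<le> 1/2"
  shows "y \<le> sin (pi * y)"
proof -
  have "\<bar>sin (pi * y) - pi * y\<bar> \<le> inverse (fact 3) * \<bar>pi * y\<bar> ^ 3"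
    using Maclaurin_sin_bound[of "pi * y" 3] by (simp add: numeral_eq_Suc sin_coeff_def)
  also have "\<dots> = (pi * y) * (pi * y)\<^sup>2 / 6" using assms by (simp add: power3_eq_cube power2_eq_square fact_numeral)
  \<comment> \<open>Since \<open>pi * y\<close> is at most 2, the cubic remainder is at most two
    thirds of \<open>pi * y\<close>. The third that is left is at least \<open>y\<close> because
    \<open>pi > 3\<close>.\<close>
  also have "\<dots> \<le> (pi * y) * 2\<^sup>2 / 6"
    using assms pi_less_4 mult_mono[of pi 4 y "1/2"]
    by (intro divide_right_mono mult_left_mono power_mono) auto
  finally have "\<bar>sin (pi * y) - pi * y\<bar> \<le> pi * y * 2\<^sup>2 / 6" .
  then have "pi * y / 3 \<le> sin (pi * y)" unfolding abs_le_iff by simp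
  moreover have "3 * y \<le> pi * y" using pi_gt3 assms by (intro mult_right_mono) auto
  ultimately show ?thesis by linarith
qed

text \<open>The phases at \<open>a\<close> and \<open>a + l\<close> differ by
  \<open>pi * l * \<theta>\<close> whatever \<phi> is, so the two sines cannot both be small. There
  are \<open>k - l \<ge> k / 2\<close> such pairs, and each entry lies in at most two of
  them.\<close>

lemma sum_sin_squared_progression_ge:
  fixes k l :: nat and \<theta> \<phi> :: real
  assumes "2 * l \<le> k"
  shows "real k / 8 * (sin (pi * (real l * \<theta>)))\<^sup>2 \<le> (\<Sum>a=1..k. (sin (pi * (\<theta> * real a + \<phi>)))\<^sup>2)"
proof -
  define f where "f a = (sin (pi * (\<theta> * real a + \<phi>)))\<^sup>2" for a :: nat
  define s where "s = (sin (pi * (real l * \<theta>)))\<^sup>2"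
  have pair: "s / 2 \<le> f a + f (a + l)" for a
  proof -
    let ?x = "pi * (\<theta> * real a + \<phi>)" and ?y = "pi * (\<theta> * real (a + l) + \<phi>)"
    have "pi * (real l * \<theta>) = ?y - ?x" by (simp add: algebra_simps)
    then have "\<bar>sin (pi * (real l * \<theta>))\<bar> = \<bar>sin ?y * cos ?x - cos ?y * sin ?x\<bar>" by (simp only: sin_diff)
    also have "\<dots> \<le> \<bar>sin ?y\<bar> * \<bar>cos ?x\<bar> + \<bar>cos ?y\<bar> * \<bar>sin ?x\<bar>"
      by (metis abs_mult abs_triangle_ineq4)
    also have "\<dots> \<le> \<bar>sin ?y\<bar> * 1 + 1 * \<bar>sin ?x\<bar>" by (intro add_mono mult_mono) auto
    finally have "\<bar>sin (pi * (real l * \<theta>))\<bar>\<^sup>2 \<le> (\<bar>sin ?y\<bar> + \<bar>sin ?x\<bar>)\<^sup>2" by (intro power_mono) auto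
    also have "\<dots> \<le> 2 * \<bar>sin ?y\<bar>\<^sup>2 + 2 * \<bar>sin ?x\<bar>\<^sup>2"
      using sum_squares_bound[of "\<bar>sin ?y\<bar>" "\<bar>sin ?x\<bar>"] by (simp add: power2_sum)
    finally show ?thesis by (simp add: s_def f_def)
  qed
  have "real k / 4 * s \<le> (real (k - l) / 2) * s"
    using assms by (intro mult_right_mono) (auto simp: s_def)
  also have "\<dots> = (\<Sum>a=1..k-l. s / 2)" by simp
  also have "\<dots> \<le> (\<Sum>a=1..k-l. f a + f (a + l))" by (intro sum_mono pair)
  also have "\<dots> = (\<Sum>a=1..k-l. f a) + (\<Sum>a=1+l..k. f a)"
    using assms sum.shift_bounds_cl_nat_ivl[of f 1 l "k - l"] by (simp add: sum.distrib)
  also have "\<dots> \<le> (\<Sum>a=1..k. f a) + (\<Sum>a=1..k. f a)"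
    by (intro add_mono sum_mono2) (auto simp: f_def)
  finally show ?thesis by (simp add: s_def f_def)
qed

text \<open>It suffices to find a shift \<open>l \<le> k / 2\<close> with
  \<open>l * \<bar>\<theta>\<bar>\<close> between \<open>k * \<rho> / 3\<close> and 1/2, where the
  sine is bounded below linearly; the constant is 72 = 8 * 9. The bound is uniform in \<phi>, which
  lets all other rows of the matrix be frozen later.\<close>

lemma sum_sin_squared_ge:
  fixes k :: nat and \<theta> \<phi> \<rho> :: real
  assumes k: "k \<ge> 2" and \<rho>: "0 \<le> \<rho>" "\<rho> \<le> \<bar>\<theta>\<bar>" "k * \<rho> \<le> 3/4" and \<theta>: "\<bar>\<theta>\<bar> \<le> 1/2"
  shows "real k * (k * \<rho>)\<^sup>2 / 72 \<le> (\<Sum>a=1..k. (sin (pi * (\<theta> * real a + \<phi>)))\<^sup>2)"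
proof -
  have "\<exists>l. 2 * l \<le> k \<and> k * \<rho> / 3 \<le> l * \<bar>\<theta>\<bar> \<and> l * \<bar>\<theta>\<bar> \<le> 1/2"
  proof (cases "real (k div 2) * \<bar>\<theta>\<bar> \<le> 1/2")
    case True
    have "k \<le> 3 * (k div 2)" using k by presburger
    then have "k / 3 \<le> real (k div 2)" by linarith
    then have "k / 3 * \<rho> \<le> real (k div 2) * \<bar>\<theta>\<bar>" using \<rho> by (intro mult_mono) auto
    then show ?thesis using True by (intro exI[of _ "k div 2"]) auto
  next
    case False
    then have pos: "\<bar>\<theta>\<bar> > 0" by (cases "\<theta> = 0") auto
    \<comment> \<open>The largest shift with \<open>l * \<bar>\<theta>\<bar>\<close> at most 1/2.
      One more step overshoots 1/2, and a step is no longer than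
      \<open>l * \<bar>\<theta>\<bar>\<close>, so this product is at least 1/4; the bound 3/4 on
      \<open>k * \<rho>\<close> matches this.\<close>
    define l where "l = nat \<lfloor>1 / (2 * \<bar>\<theta>\<bar>)\<rfloor>"
    have ge1: "1 \<le> 1 / (2 * \<bar>\<theta>\<bar>)" using \<theta> pos by (simp add: field_simps)
    then have l: "real l = of_int \<lfloor>1 / (2 * \<bar>\<theta>\<bar>)\<rfloor>" "1 \<le> l" unfolding l_def by (auto simp: le_nat_iff le_floor_iff)
    have up: "l * \<bar>\<theta>\<bar> \<le> 1/2"
    proof -
      have "real l \<le> 1 / (2 * \<bar>\<theta>\<bar>)" unfolding l(1) by (rule of_int_floor_le)
      then show ?thesis using pos by (simp add: field_simps)
    qed
    have "1 / (2 * \<bar>\<theta>\<bar>) < real l + 1" unfolding l(1) by linarith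
    then have "1/2 < l * \<bar>\<theta>\<bar> + \<bar>\<theta>\<bar>" using pos by (simp add: field_simps)
    moreover have "1 * \<bar>\<theta>\<bar> \<le> l * \<bar>\<theta>\<bar>" using l(2) by (intro mult_right_mono) auto
    ultimately have low: "1/4 \<le> l * \<bar>\<theta>\<bar>" by linarith
    have "real l * \<bar>\<theta>\<bar> < real (k div 2) * \<bar>\<theta>\<bar>" using up False by linarith
    then have "l < k div 2" using pos by simp
    then show ?thesis using up low \<rho>(3) by (intro exI[of _ l]) auto
  qed
  then obtain l where l: "2 * l \<le> k" "k * \<rho> / 3 \<le> l * \<bar>\<theta>\<bar>" "l * \<bar>\<theta>\<bar> \<le> 1/2" by blast
  have "k * \<rho> / 3 \<le> sin (pi * (l * \<bar>\<theta>\<bar>))" using sin_pi_ge[of "l * \<bar>\<theta>\<bar>"] l by simp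
  then have "(k * \<rho> / 3)\<^sup>2 \<le> (sin (pi * (l * \<bar>\<theta>\<bar>)))\<^sup>2" using \<rho> by (intro power_mono) auto
  also have "\<dots> = (sin (pi * (l * \<theta>)))\<^sup>2" by (cases "\<theta> \<ge> 0") (auto simp: abs_if)
  finally have "real k / 8 * (k * \<rho> / 3)\<^sup>2 \<le> real k / 8 * (sin (pi * (l * \<theta>)))\<^sup>2"
    by (intro mult_left_mono) auto
  also have "\<dots> \<le> (\<Sum>a=1..k. (sin (pi * (\<theta> * real a + \<phi>)))\<^sup>2)"
    by (rule sum_sin_squared_progression_ge[OF l(1)])
  finally show ?thesis by (simp add: power_divide)
qed

subsection \<open>Rounding at a grid minimiser of the smoothed dual\<close>

definition reduced_cost :: "nat \<Rightarrow> (nat \<times> nat \<Rightarrow> nat) \<Rightarrow> (nat \<Rightarrow> real) \<Rightarrow> (nat \<Rightarrow> real) \<Rightarrow> nat \<Rightarrow> real"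
  where "reduced_cost m A c u j = c j - (\<Sum>i<m. u i * real (A (i, j)))"

definition smooth_pos :: "real \<Rightarrow> real \<Rightarrow> real"
  where "smooth_pos \<delta> r = (max 0 (r - \<delta>) + max 0 (r + \<delta>)) / 2"

text \<open>The right derivative of \<open>smooth_pos \<delta>\<close>. The closed comparisons make
  the interval with slope 1/2 half-open.\<close>

definition smooth_slope :: "real \<Rightarrow> real \<Rightarrow> real"
  where "smooth_slope \<delta> r = (of_bool (\<delta> \<le> r) + of_bool (- \<delta> \<le> r)) / 2"

definition smooth_dual ::
  "nat \<Rightarrow> nat \<Rightarrow> (nat \<times> nat \<Rightarrow> nat) \<Rightarrow> (nat \<Rightarrow> real) \<Rightarrow> (nat \<Rightarrow> real) \<Rightarrow> real \<Rightarrow> (nat \<Rightarrow> real) \<Rightarrow> real"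
  where "smooth_dual m n A b c \<delta> u =
    (\<Sum>i<m. b i * u i) + (\<Sum>j<n. smooth_pos \<delta> (reduced_cost m A c u j))"

text \<open>Convexity: the change over a step \<open>h\<close> is controlled by the slope at its far
  end or beyond. Going on to distance \<open>h'\<close> allows one common shift for all
  columns.\<close>

lemma smooth_pos_diff_le:
  assumes "0 \<le> h" "h \<le> h'"
  shows "smooth_pos \<delta> (r - h) - smooth_pos \<delta> r \<le> - h * smooth_slope \<delta> (r - h')"
    and "smooth_pos \<delta> (r + h) - smooth_pos \<delta> r \<le> h * smooth_slope \<delta> (r + h')"
  using assms by (auto simp: smooth_pos_def smooth_slope_def max_def field_simps)

lemma smooth_slope_diff_le:
  assumes "0 \<le> h"
  shows "smooth_slope \<delta> (r + h) - smooth_slope \<delta> (r - h) \<le> of_bool (\<bar>r - \<delta>\<bar> \<le> h \<or> \<bar>r + \<delta>\<bar> \<le> h)"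
  using assms by (auto simp: smooth_slope_def)

lemma smooth_slope_mono: "x \<le> y \<Longrightarrow> smooth_slope \<delta> x \<le> smooth_slope \<delta> y"
  by (auto simp: smooth_slope_def)

lemma sum_fun_upd_add:
  fixes u f :: "nat \<Rightarrow> real"
  assumes "i < m"
  shows "(\<Sum>i'<m. (u(i := u i + h)) i' * f i') = (\<Sum>i'<m. u i' * f i') + h * f i"
proof -
  have "(u(i := u i + h)) i' * f i' = u i' * f i' + (if i' = i then h * f i else 0)" for i'
    by (simp add: algebra_simps)
  then show ?thesis using assms by (simp add: sum.distrib)
qed

lemma smooth_dual_upd:
  assumes "i < m"
  shows "smooth_dual m n A b c \<delta> (u(i := u i + h)) - smooth_dual m n A b c \<delta> u =
    b i * h + (\<Sum>j<n. smooth_pos \<delta> (reduced_cost m A c u j - h * real (A (i, j))) - smooth_pos \<delta> (reduced_cost m A c u j))"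
proof -
  have "reduced_cost m A c (u(i := u i + h)) j = reduced_cost m A c u j - h * real (A (i, j))" for j
    using sum_fun_upd_add[OF assms, of u h "\<lambda>i'. real (A (i', j))"] by (simp add: reduced_cost_def del: fun_upd_apply)
  moreover have "(\<Sum>i'<m. b i' * (u(i := u i + h)) i') = (\<Sum>i'<m. b i' * u i') + b i * h"
    using sum_fun_upd_add[OF assms, of u h b] by (simp add: mult.commute)
  ultimately show ?thesis by (simp add: smooth_dual_def sum_subtractf)
qed

context
  fixes m n k :: nat and A :: "nat \<times> nat \<Rightarrow> nat" and b c u :: "nat \<Rightarrow> real" and \<delta> \<eta> :: real
  assumes \<delta>: "0 < \<delta>" and \<eta>: "0 < \<eta>"
    and Ak: "\<And>i j. i < m \<Longrightarrow> j < n \<Longrightarrow> A (i, j) \<le> k"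
begin

text \<open>
  The slopes are taken at \<open>r \<plusminus> \<eta> k\<close> because moving one coordinate of \<open>u\<close> by \<open>\<eta>\<close> moves each reduced cost
  by at most \<open>\<eta> k\<close>.
\<close>

lemma slope_sum_le:
  assumes "i < m" and up: "smooth_dual m n A b c \<delta> u \<le> smooth_dual m n A b c \<delta> (u(i := u i + \<eta>))"
  shows "(\<Sum>j<n. real (A (i, j)) * smooth_slope \<delta> (reduced_cost m A c u j - \<eta> * k)) \<le> b i"
proof -
  have "0 \<le> b i * \<eta> + (\<Sum>j<n. smooth_pos \<delta> (reduced_cost m A c u j - \<eta> * real (A (i, j))) - smooth_pos \<delta> (reduced_cost m A c u j))"
    using up smooth_dual_upd[OF assms(1), of n A b c \<delta> u \<eta>] by linarith
  also have "\<dots> \<le> b i * \<eta> + (\<Sum>j<n. - (\<eta> * real (A (i, j))) * smooth_slope \<delta> (reduced_cost m A c u j - \<eta> * k))"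
    using \<eta> Ak[OF assms(1)]
    by (intro add_left_mono sum_mono smooth_pos_diff_le) (auto simp: field_simps)
  also have "\<dots> = \<eta> * (b i - (\<Sum>j<n. real (A (i, j)) * smooth_slope \<delta> (reduced_cost m A c u j - \<eta> * k)))"
    by (simp add: algebra_simps sum_distrib_left sum_negf)
  finally show ?thesis using \<eta> by (simp add: zero_le_mult_iff)
qed

lemma slope_sum_ge:
  assumes "i < m" and down: "smooth_dual m n A b c \<delta> u \<le> smooth_dual m n A b c \<delta> (u(i := u i - \<eta>))"
  shows "b i \<le> (\<Sum>j<n. real (A (i, j)) * smooth_slope \<delta> (reduced_cost m A c u j + \<eta> * k))"
proof -
  have "0 \<le> - (b i * \<eta>) + (\<Sum>j<n. smooth_pos \<delta> (reduced_cost m A c u j + \<eta> * real (A (i, j))) - smooth_pos \<delta> (reduced_cost m A c u j))"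
    using down smooth_dual_upd[OF assms(1), of n A b c \<delta> u "- \<eta>"] by simp
  also have "\<dots> \<le> - (b i * \<eta>) + (\<Sum>j<n. (\<eta> * real (A (i, j))) * smooth_slope \<delta> (reduced_cost m A c u j + \<eta> * k))"
    using \<eta> Ak[OF assms(1)]
    by (intro add_left_mono sum_mono smooth_pos_diff_le) (auto simp: field_simps)
  also have "\<dots> = \<eta> * ((\<Sum>j<n. real (A (i, j)) * smooth_slope \<delta> (reduced_cost m A c u j + \<eta> * k)) - b i)"
    by (simp add: algebra_simps sum_distrib_left)
  finally show ?thesis using \<eta> by (simp add: zero_le_mult_iff)
qed

text \<open>Approximate complementary slackness. The slope sum at the upward shift is at least
  \<open>b i\<close>; passing to the downward shift changes only columns whose reduced cost comes
  within \<open>\<eta> * k\<close> of a kink, each by at most \<open>k\<close>.\<close>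

lemma slope_sum_deficit:
  assumes "i < m" and down: "smooth_dual m n A b c \<delta> u \<le> smooth_dual m n A b c \<delta> (u(i := u i - \<eta>))"
  shows "b i - (\<Sum>j<n. real (A (i, j)) * smooth_slope \<delta> (reduced_cost m A c u j - \<eta> * k))
    \<le> real (card {j. j < n \<and> (\<bar>reduced_cost m A c u j - \<delta>\<bar> \<le> \<eta> * k \<or> \<bar>reduced_cost m A c u j + \<delta>\<bar> \<le> \<eta> * k)}) * k"
proof -
  define S where "S = {j. j < n \<and> (\<bar>reduced_cost m A c u j - \<delta>\<bar> \<le> \<eta> * k \<or> \<bar>reduced_cost m A c u j + \<delta>\<bar> \<le> \<eta> * k)}"
  have "b i - (\<Sum>j<n. real (A (i, j)) * smooth_slope \<delta> (reduced_cost m A c u j - \<eta> * k))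
    \<le> (\<Sum>j<n. real (A (i, j)) * (smooth_slope \<delta> (reduced_cost m A c u j + \<eta> * k) - smooth_slope \<delta> (reduced_cost m A c u j - \<eta> * k)))"
    using slope_sum_ge[OF assms] by (simp add: sum_subtractf right_diff_distrib)
  also have "\<dots> \<le> (\<Sum>j<n. real k * of_bool (j \<in> S))"
  proof (rule sum_mono)
    fix j assume "j \<in> {..<n}"
    then have "of_bool (\<bar>reduced_cost m A c u j - \<delta>\<bar> \<le> \<eta> * k \<or> \<bar>reduced_cost m A c u j + \<delta>\<bar> \<le> \<eta> * k) = (of_bool (j \<in> S) :: real)" by (simp add: S_def)
    then show "real (A (i, j)) * (smooth_slope \<delta> (reduced_cost m A c u j + \<eta> * k) - smooth_slope \<delta> (reduced_cost m A c u j - \<eta> * k)) \<le> real k * of_bool (j \<in> S)"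
      using smooth_slope_diff_le[of "\<eta> * k" \<delta> "reduced_cost m A c u j"] smooth_slope_mono[of "reduced_cost m A c u j - \<eta> * k" "reduced_cost m A c u j + \<eta> * k" \<delta>]
        Ak[OF assms(1), of j] \<eta> \<open>j \<in> {..<n}\<close>
      by (intro mult_mono) auto
  qed
  also have "\<dots> = real k * real (card ({..<n} \<inter> S))"
    by (simp add: sum_distrib_left[symmetric] of_bool_def sum.If_cases)
  also have "{..<n} \<inter> S = S" by (auto simp: S_def)
  finally show ?thesis by (simp add: mult.commute S_def)
qed

section \<open>Weak duality and the rounding of window columns\<close>

text \<open>Weak duality, with the box constraints turned into positive parts. The positive part is
  the unsmoothed one: smoothing only serves to select \<open>u\<close>.\<close>

lemma val_LP_le_dual:
  assumes y: "y \<in> feasible m n (\<lambda>i j. real (A (i, j))) b {0..1}" and u: "\<And>i. i < m \<Longrightarrow> 0 \<le> u i"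
  shows "(\<Sum>j<n. c j * y j) \<le> (\<Sum>i<m. u i * b i) + (\<Sum>j<n. max 0 (reduced_cost m A c u j))"
proof -
  have "(\<Sum>j<n. c j * y j) = (\<Sum>i<m. u i * (\<Sum>j<n. real (A (i, j)) * y j)) + (\<Sum>j<n. reduced_cost m A c u j * y j)"
  proof -
    have "(\<Sum>i<m. u i * (\<Sum>j<n. real (A (i, j)) * y j)) = (\<Sum>j<n. (\<Sum>i<m. u i * real (A (i, j))) * y j)"
      unfolding sum_distrib_left sum_distrib_right by (subst sum.swap) (simp add: mult_ac)
    then show ?thesis by (simp add: reduced_cost_def left_diff_distrib sum_subtractf)
  qed
  also have "\<dots> \<le> (\<Sum>i<m. u i * b i) + (\<Sum>j<n. max 0 (reduced_cost m A c u j))"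
  proof (intro add_mono sum_mono)
    show "u i * (\<Sum>j<n. real (A (i, j)) * y j) \<le> u i * b i" if "i \<in> {..<m}" for i
      using y u that by (intro mult_left_mono) (auto simp: feasible_def)
    show "reduced_cost m A c u j * y j \<le> max 0 (reduced_cost m A c u j)" if "j \<in> {..<n}" for j
    proof -
      have "0 \<le> y j" "y j \<le> 1" using y that by (auto simp: feasible_def PiE_iff)
      then have "reduced_cost m A c u j * y j \<le> max 0 (reduced_cost m A c u j) * 1" by (intro mult_mono) auto
      then show ?thesis by simp
    qed
  qed
  finally show ?thesis .
qed

text \<open>The slopes put 1 on \<open>B\<close>, 1/2 on the window \<open>W\<close> and 0
  elsewhere. Replacing the halves by a subset with exactly prescribed sums restores integrality and
  makes every constraint with positive multiplier tight. Weak duality can then be compared column by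
  column, and only window columns lose, at most \<open>2 * \<delta>\<close> each.\<close>

lemma IPGAP_le_window:
  fixes K L :: real and H :: nat
  assumes m: "m \<ge> 1" and k: "k \<ge> 1" and \<eta>k: "\<eta> * k \<le> \<delta> / 2" and K: "1 \<le> K"
    and b: "\<And>i. i < m \<Longrightarrow> b i \<in> \<int>"
    and u: "\<And>i. i < m \<Longrightarrow> 0 \<le> u i"
    and up: "\<And>i. i < m \<Longrightarrow> smooth_dual m n A b c \<delta> u \<le> smooth_dual m n A b c \<delta> (u(i := u i + \<eta>))"
    and down: "\<And>i. i < m \<Longrightarrow> 0 < u i \<Longrightarrow> smooth_dual m n A b c \<delta> u \<le> smooth_dual m n A b c \<delta> (u(i := u i - \<eta>))"
    and few: "card {j. j < n \<and> (\<bar>reduced_cost m A c u j - \<delta>\<bar> \<le> \<eta> * k \<or> \<bar>reduced_cost m A c u j + \<delta>\<bar> \<le> \<eta> * k)} \<le> K"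
    and H: "real n * k / 2 + K * k < real (2 * H + 1)"
    and far: "\<And>l i. l \<in> {..<m} \<rightarrow>\<^sub>E {..<2 * H + 1} \<Longrightarrow> i < m \<Longrightarrow>
        1 / (4 * m * K * k) < \<bar>(real (l i) - real H) / real (2 * H + 1)\<bar> \<Longrightarrow>
        L \<le> (\<Sum>j | j < n \<and> \<bar>reduced_cost m A c u j\<bar> \<le> \<delta> / 2.
              (sin (pi * (\<Sum>i<m. (real (l i) - real H) / real (2 * H + 1) * A (i, j))))\<^sup>2)"
    and L: "real (2 * H + 1) ^ m \<le> exp (L / 2)"
  shows "IPGAP m n (\<lambda>i j. real (A (i, j))) b c \<le> 2 * \<delta> * card {j. j < n \<and> \<bar>reduced_cost m A c u j\<bar> \<le> 2 * \<delta>}"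
proof -
  \<comment> \<open>The window is taken for the shifted costs \<open>r - \<eta> * k\<close>, at
    which \<open>slope_sum_le\<close> bounds the slope sum by \<open>b i\<close>.\<close>
  define W where "W = {j. j < n \<and> - \<delta> \<le> reduced_cost m A c u j - \<eta> * k \<and> reduced_cost m A c u j - \<eta> * k < \<delta>}"
  define B where "B = {j. j < n \<and> \<delta> \<le> reduced_cost m A c u j - \<eta> * k}"
  have fin: "finite W" "finite B" and WB: "W \<inter> B = {}" "W \<subseteq> {..<n}" "B \<subseteq> {..<n}"
    by (auto simp: W_def B_def)
  define s where "s i = (\<Sum>j\<in>W. int (A (i, j)))" for i
  define base where "base i = (\<Sum>j\<in>B. int (A (i, j)))" for i
  \<comment> \<open>A constraint with positive multiplier has to become exactly tight, and
    integrality of \<open>b\<close> makes the floor exact. For the others, half of the window sum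
    rounded down keeps feasibility.\<close>
  define t where "t i = (if 0 < u i then \<lfloor>b i\<rfloor> - base i else s i div 2)" for i
  have slope: "(\<Sum>j<n. real (A (i, j)) * smooth_slope \<delta> (reduced_cost m A c u j - \<eta> * k)) = base i + s i / 2" for i
  proof -
    have "(\<Sum>j<n. real (A (i, j)) * smooth_slope \<delta> (reduced_cost m A c u j - \<eta> * k))
      = (\<Sum>j<n. (if j \<in> B then real (A (i, j)) else 0) + (if j \<in> W then real (A (i, j)) / 2 else 0))"
      using \<delta> by (intro sum.cong refl) (auto simp: smooth_slope_def W_def B_def)
    also have "\<dots> = base i + s i / 2"
      using WB by (simp add: sum.distrib sum.inter_restrict[symmetric] Int_absorb1 base_def s_def sum_divide_distrib)
    finally show ?thesis .
  qed
  have lower: "base i + s i / 2 \<le> b i" if "i < m" for i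
    using slope_sum_le[OF that up[OF that]] by (simp add: slope)
  have upper: "b i - (base i + s i / 2) \<le> K * k" if "i < m" "0 < u i" for i
  proof -
    have "real (card {j. j < n \<and> (\<bar>reduced_cost m A c u j - \<delta>\<bar> \<le> \<eta> * k \<or> \<bar>reduced_cost m A c u j + \<delta>\<bar> \<le> \<eta> * k)}) * k \<le> K * k"
      using few by (intro mult_right_mono) auto
    then show ?thesis using slope_sum_deficit[OF that(1) down[OF that]] by (simp add: slope)
  qed
  have Kk: "1 \<le> K * k" using K k mult_mono[of 1 K 1 "real k"] by simp
  have D: "\<bar>s i / 2 - t i\<bar> \<le> K * k" if "i < m" for i
  proof (cases "0 < u i")
    case True
    have "real_of_int \<lfloor>b i\<rfloor> = b i" using b[OF that] by simp
    then have "real_of_int (t i) = b i - base i" using True by (simp only: t_def if_True of_int_diff)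
    then show ?thesis using lower[OF that] upper[OF that True] Kk by linarith
  next
    case False
    have "\<bar>s i / 2 - (s i div 2 :: int)\<bar> \<le> 1" by linarith
    then show ?thesis using False Kk by (simp add: t_def)
  qed
  have s_le: "0 \<le> s i" "s i \<le> real n * k" if "i < m" for i
  proof -
    show "0 \<le> s i" by (simp add: s_def sum_nonneg)
    have "s i \<le> (\<Sum>j\<in>W. int k)" unfolding s_def using Ak[OF that] WB by (intro sum_mono) auto
    also have "\<dots> = int (card W * k)" by simp
    also have "\<dots> \<le> int (n * k)" using card_mono[OF _ WB(2)] by (intro of_nat_mono mult_right_mono) auto
    finally show "s i \<le> real n * k" by (metis of_int_le_iff of_int_of_nat_eq of_nat_mult)
  qed
  obtain T where T: "T \<subseteq> W" "\<And>i. i < m \<Longrightarrow> (\<Sum>j\<in>T. int (A (i, j))) = t i"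
  proof (rule subset_sum_hit[OF fin(1), of m "\<lambda>i j. int (A (i, j))" t H k "K * k" "1 / (4 * m * K * k)" L])
    fix T i assume TW: "T \<subseteq> W" and i: "i < m"
    have "(\<Sum>j\<in>T. int (A (i, j))) \<le> s i" unfolding s_def using TW fin by (intro sum_mono2) auto
    moreover have "0 \<le> (\<Sum>j\<in>T. int (A (i, j)))" by (simp add: sum_nonneg)
    \<comment> \<open>Every subset sum lies within \<open>s i / 2\<close> of the midpoint
      \<open>s i / 2\<close>, and \<open>t i\<close> lies within \<open>K * k\<close> of it. Hence
      the modulus only has to exceed \<open>n * k / 2 + K * k\<close>.\<close>
    ultimately have "\<bar>real_of_int (\<Sum>j\<in>T. int (A (i, j))) - s i / 2\<bar> \<le> s i / 2" by linarith
    then have "\<bar>real_of_int (\<Sum>j\<in>T. int (A (i, j))) - t i\<bar> < real (2 * H + 1)"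
      using D[OF i] s_le[OF i] H by linarith
    then have "\<bar>real_of_int ((\<Sum>j\<in>T. int (A (i, j))) - t i)\<bar> < real (2 * H + 1)" by simp
    then show "\<bar>(\<Sum>j\<in>T. int (A (i, j))) - t i\<bar> < int (2 * H + 1)"
      by (metis of_int_abs of_int_less_iff of_int_of_nat_eq)
  next
    show "\<bar>int (A (i, j))\<bar> \<le> real k" if "i < m" "j \<in> W" for i j
      using Ak[OF that(1), of j] that(2) WB by auto
    show "\<bar>real_of_int (\<Sum>j\<in>W. int (A (i, j))) / 2 - real_of_int (t i)\<bar> \<le> K * k" if "i < m" for i
      using D[OF that] by (simp add: s_def)
    show "0 \<le> 1 / (4 * m * K * k)" using K by simp
    show "m * (1 / (4 * m * K * k)) * (K * k) \<le> 1/4" using m k K by (simp add: field_simps)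
    show "m * (1 / (4 * m * K * k)) * k \<le> 1/2" using m k K by (simp add: field_simps)
    show "real (2 * H + 1) ^ m \<le> exp (L / 2)" by fact
  next
    fix l i
    assume l: "l \<in> {..<m} \<rightarrow>\<^sub>E {..<2 * H + 1}" and i: "i < m"
      and "1 / (4 * m * K * k) < \<bar>(real (l i) - real H) / real (2 * H + 1)\<bar>"
    then have "L \<le> (\<Sum>j | j < n \<and> \<bar>reduced_cost m A c u j\<bar> \<le> \<delta> / 2.
              (sin (pi * (\<Sum>i<m. (real (l i) - real H) / real (2 * H + 1) * A (i, j))))\<^sup>2)"
      by (rule far)
    \<comment> \<open>The symmetric window of radius \<open>\<delta> / 2\<close> fits into the
      shifted one because \<open>\<eta> * k \<le> \<delta> / 2\<close>; further columns only
      increase the sum.\<close>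
    also have "\<dots> \<le> (\<Sum>j\<in>W. (sin (pi * (\<Sum>i<m. (real (l i) - real H) / real (2 * H + 1) * A (i, j))))\<^sup>2)"
    proof (rule sum_mono2[OF fin(1)])
      have "0 \<le> \<eta> * k" using \<eta> by simp
      then show "{j. j < n \<and> \<bar>reduced_cost m A c u j\<bar> \<le> \<delta> / 2} \<subseteq> W" using \<delta> \<eta>k by (auto simp: W_def)
    qed simp
    finally show "L \<le> (\<Sum>j\<in>W. (sin (pi * (\<Sum>i<m. (real (l i) - real H) / real (2 * H + 1) * real_of_int (int (A (i, j))))))\<^sup>2)"
      by simp
  qed auto
  define x where "x = restrict (\<lambda>j. if j \<in> B \<union> T then 1 else 0 :: real) {..<n}"
  have Tn: "T \<subseteq> {..<n}" "B \<inter> T = {}" "finite T" using T(1) WB fin finite_subset by blast+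
  have Ax: "(\<Sum>j<n. real (A (i, j)) * x j) = base i + t i" if "i < m" for i
  proof -
    have "(\<Sum>j<n. real (A (i, j)) * x j) = (\<Sum>j<n. if j \<in> B \<union> T then real (A (i, j)) else 0)"
      by (intro sum.cong refl) (auto simp: x_def)
    also have "\<dots> = (\<Sum>j\<in>B \<union> T. real (A (i, j)))"
      using Tn WB by (simp add: sum.inter_restrict[symmetric] Int_absorb1 del: Un_iff)
    also have "\<dots> = (\<Sum>j\<in>B. real (A (i, j))) + (\<Sum>j\<in>T. real (A (i, j)))"
      using Tn fin by (intro sum.union_disjoint) auto
    also have "(\<Sum>j\<in>T. real (A (i, j))) = t i" using T(2)[OF that, symmetric] by simp
    finally show ?thesis by (simp add: base_def)
  qed
  have Ax_le: "(\<Sum>j<n. real (A (i, j)) * x j) \<le> b i" and tight: "0 < u i \<Longrightarrow> (\<Sum>j<n. real (A (i, j)) * x j) = b i" if "i < m" for i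
  proof -
    have fl: "real_of_int \<lfloor>b i\<rfloor> = b i" using b[OF that] by simp
    then show "0 < u i \<Longrightarrow> (\<Sum>j<n. real (A (i, j)) * x j) = b i"
      by (simp add: Ax[OF that] t_def)
    have "(s i div 2 :: int) \<le> s i / 2" by linarith
    then show "(\<Sum>j<n. real (A (i, j)) * x j) \<le> b i"
      using fl lower[OF that] by (simp add: Ax[OF that] t_def)
  qed
  have x: "x \<in> feasible m n (\<lambda>i j. real (A (i, j))) b {0, 1}"
    using Ax_le by (auto simp: feasible_def x_def)
  have IP: "(\<Sum>j<n. c j * x j) \<le> val_IP m n (\<lambda>i j. real (A (i, j))) b c"
    using val_IP_attained[of m n "\<lambda>i j. real (A (i, j))" b c] x by blast
  have "x \<in> feasible m n (\<lambda>i j. real (A (i, j))) b {0..1}"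
    using x PiE_mono[of "{..<n}" "\<lambda>_. {0, 1}" "\<lambda>_. {0..1::real}"] by (auto simp: feasible_def)
  then have "feasible m n (\<lambda>i j. real (A (i, j))) b {0..1} \<noteq> {}" by blast
  then obtain y where y: "y \<in> feasible m n (\<lambda>i j. real (A (i, j))) b {0..1}"
    "val_LP m n (\<lambda>i j. real (A (i, j))) b c = (\<Sum>j<n. c j * y j)"
    by (rule val_LP_attained)
  have LP: "val_LP m n (\<lambda>i j. real (A (i, j))) b c \<le> (\<Sum>i<m. u i * b i) + (\<Sum>j<n. max 0 (reduced_cost m A c u j))"
    unfolding y(2) by (rule val_LP_le_dual[OF y(1) u])
  have cx: "(\<Sum>j<n. c j * x j) = (\<Sum>i<m. u i * b i) + (\<Sum>j<n. reduced_cost m A c u j * x j)"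
  proof -
    \<comment> \<open>Exact complementary slackness: either the multiplier is 0 or the constraint is
      tight at \<open>x\<close>.\<close>
    have "(\<Sum>i<m. u i * b i) = (\<Sum>i<m. u i * (\<Sum>j<n. real (A (i, j)) * x j))"
    proof (intro sum.cong refl)
      fix i assume "i \<in> {..<m}"
      then show "u i * b i = u i * (\<Sum>j<n. real (A (i, j)) * x j)"
        using tight[of i] u[of i] by (cases "u i = 0") auto
    qed
    also have "\<dots> = (\<Sum>j<n. (\<Sum>i<m. u i * real (A (i, j))) * x j)"
      unfolding sum_distrib_left sum_distrib_right by (subst sum.swap) (simp add: mult_ac)
    finally show ?thesis by (simp add: reduced_cost_def left_diff_distrib sum_subtractf)
  qed
  have "IPGAP m n (\<lambda>i j. real (A (i, j))) b c \<le> (\<Sum>j<n. max 0 (reduced_cost m A c u j) - reduced_cost m A c u j * x j)"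
    using LP IP cx by (simp add: IPGAP_def sum_subtractf)
  \<comment> \<open>Outside \<open>W\<close> the value of \<open>x\<close> agrees with the sign of
    the reduced cost and nothing is lost. Inside \<open>W\<close> the loss is at most the absolute
    reduced cost.\<close>
  also have "\<dots> \<le> (\<Sum>j<n. if j \<in> {j. j < n \<and> \<bar>reduced_cost m A c u j\<bar> \<le> 2 * \<delta>} then 2 * \<delta> else 0)"
  proof (rule sum_mono)
    fix j assume j: "j \<in> {..<n}"
    have hk: "0 \<le> \<eta> * k" using \<eta> by simp
    consider "j \<in> B" | "j \<in> W" | "j \<notin> B" "j \<notin> W" by blast
    then show "max 0 (reduced_cost m A c u j) - reduced_cost m A c u j * x j \<le> (if j \<in> {j. j < n \<and> \<bar>reduced_cost m A c u j\<bar> \<le> 2 * \<delta>} then 2 * \<delta> else 0)"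
    proof cases
      case 1
      then have "x j = 1" using j by (simp add: x_def)
      moreover have "reduced_cost m A c u j \<ge> 0" using 1 hk \<delta> by (auto simp: B_def)
      ultimately show ?thesis using \<delta> by simp
    next
      case 2
      then have "\<bar>reduced_cost m A c u j\<bar> \<le> 2 * \<delta>" using hk \<eta>k \<delta> by (auto simp: W_def)
      moreover have "x j = 0 \<or> x j = 1" using j by (simp add: x_def)
      ultimately show ?thesis using j by auto
    next
      case 3
      then have "x j = 0" using j T(1) by (auto simp: x_def)
      moreover have "reduced_cost m A c u j \<le> 0" using 3 j \<eta>k \<delta> by (auto simp: W_def B_def)
      ultimately show ?thesis using \<delta> by simp
    qed
  qed
  also have "\<dots> = 2 * \<delta> * card {j. j < n \<and> \<bar>reduced_cost m A c u j\<bar> \<le> 2 * \<delta>}"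
    by (simp add: sum.If_cases Int_def)
  finally show ?thesis .
qed

end

section \<open>Minimisers of the smoothed dual over a grid\<close>

text \<open>The lower bound on \<open>b\<close> makes the objective at least
  \<open>k * n * \<beta>\<close> times the sum of the multipliers, while its value at 0 is at most
  \<open>5 * n\<close>. By the size of \<open>G\<close> the minimiser therefore stays below the top
  of the grid, so its upward neighbours are grid points; a downward neighbour needs only
  \<open>0 < g i\<close>.\<close>

lemma grid_minimizer:
  fixes b c :: "nat \<Rightarrow> real" and \<delta> \<eta> \<beta> :: real and G :: nat
  assumes n: "n \<ge> 1" and k: "k \<ge> 1" and \<beta>: "0 < \<beta>" and \<delta>: "0 \<le> \<delta>" "\<delta> \<le> 1" and \<eta>: "0 < \<eta>"
    and b: "\<And>i. i < m \<Longrightarrow> real k * real n * \<beta> \<le> b i"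
    and c: "(\<Sum>j<n. \<bar>c j\<bar>) \<le> 4 * real n"
    and G: "5 < k * \<beta> * (\<eta> * (real G - 1))"
  obtains g where "g \<in> {..<m} \<rightarrow>\<^sub>E {..<G}" "k * \<beta> * (\<Sum>i<m. \<eta> * real (g i)) \<le> 5"
    "\<And>i. i < m \<Longrightarrow> smooth_dual m n A b c \<delta> (\<lambda>i. \<eta> * real (g i)) \<le> smooth_dual m n A b c \<delta> ((\<lambda>i. \<eta> * real (g i))(i := \<eta> * real (g i) + \<eta>))"
    "\<And>i. i < m \<Longrightarrow> 0 < g i \<Longrightarrow> smooth_dual m n A b c \<delta> (\<lambda>i. \<eta> * real (g i)) \<le> smooth_dual m n A b c \<delta> ((\<lambda>i. \<eta> * real (g i))(i := \<eta> * real (g i) - \<eta>))"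
proof -
  let ?Q = "{..<m} \<rightarrow>\<^sub>E {..<G}"
  define \<Phi> where "\<Phi> g = smooth_dual m n A b c \<delta> (\<lambda>i. \<eta> * real (g i))" for g :: "nat \<Rightarrow> nat"
  have G1: "1 < G"
  proof (rule ccontr)
    assume "\<not> 1 < G"
    then have "k * \<beta> * (\<eta> * (real G - 1)) \<le> 0"
      using k \<beta> \<eta> by (intro mult_nonneg_nonpos) auto
    then show False using G by simp
  qed
  define z :: "nat \<Rightarrow> nat" where "z = restrict (\<lambda>_. 0) {..<m}"
  have z: "z \<in> ?Q" using G1 by (auto simp: z_def)
  have finQ: "finite ?Q" by (intro finite_PiE) auto
  obtain g where g: "g \<in> ?Q" "\<And>g'. g' \<in> ?Q \<Longrightarrow> \<Phi> g \<le> \<Phi> g'"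
    using arg_min_if_finite[OF finQ, of \<Phi>] z by (metis empty_iff not_le)
  have "k * n * \<beta> * (\<Sum>i<m. \<eta> * real (g i)) \<le> (\<Sum>i<m. b i * (\<eta> * real (g i)))"
    unfolding sum_distrib_left using b \<eta> by (intro sum_mono mult_right_mono) auto
  also have "\<dots> \<le> \<Phi> g"
    by (simp add: \<Phi>_def smooth_dual_def smooth_pos_def sum_nonneg)
  also have "\<dots> \<le> \<Phi> z" by (rule g(2)[OF z])
  also have "\<dots> = (\<Sum>j<n. smooth_pos \<delta> (c j))"
    by (simp add: \<Phi>_def smooth_dual_def reduced_cost_def z_def)
  also have "\<dots> \<le> (\<Sum>j<n. \<bar>c j\<bar> + \<delta>)" using \<delta> by (intro sum_mono) (auto simp: smooth_pos_def max_def)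
  also have "\<dots> \<le> n * 5" using c \<delta> mult_left_mono[OF \<delta>(2), of "real n"] by (simp add: sum.distrib)
  finally have "n * (k * \<beta> * (\<Sum>i<m. \<eta> * real (g i))) \<le> n * 5" by (simp add: mult_ac)
  then have bound: "k * \<beta> * (\<Sum>i<m. \<eta> * real (g i)) \<le> 5" using n by simp
  show thesis
  proof (rule that[OF g(1) bound])
    fix i assume i: "i < m"
    have "\<eta> * real (g i) \<le> (\<Sum>i<m. \<eta> * real (g i))" using i \<eta> by (intro member_le_sum) auto
    then have "k * \<beta> * (\<eta> * real (g i)) \<le> 5" using bound \<beta> by (meson mult_left_mono mult_nonneg_nonneg of_nat_0_le_iff less_imp_le order_trans)
    then have "k * \<beta> * (\<eta> * real (g i)) < k * \<beta> * (\<eta> * (real G - 1))" using G by linarith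
    then have "real (g i) < real G - 1" using k \<beta> \<eta> by (simp add: mult_less_cancel_left_pos)
    then have "Suc (g i) < G" by linarith
    then have "g(i := Suc (g i)) \<in> ?Q" using g(1) i by (auto simp: PiE_iff extensional_def)
    then have "\<Phi> g \<le> \<Phi> (g(i := Suc (g i)))" by (rule g(2))
    also have "(\<lambda>i'. \<eta> * real ((g(i := Suc (g i))) i')) = (\<lambda>i. \<eta> * real (g i))(i := \<eta> * real (g i) + \<eta>)"
      by (auto simp: fun_eq_iff algebra_simps)
    then have "\<Phi> (g(i := Suc (g i))) = smooth_dual m n A b c \<delta> ((\<lambda>i. \<eta> * real (g i))(i := \<eta> * real (g i) + \<eta>))"
      by (simp only: \<Phi>_def)
    finally show "smooth_dual m n A b c \<delta> (\<lambda>i. \<eta> * real (g i)) \<le> smooth_dual m n A b c \<delta> ((\<lambda>i. \<eta> * real (g i))(i := \<eta> * real (g i) + \<eta>))"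
      by (simp only: \<Phi>_def)
  next
    fix i assume i: "i < m" "0 < g i"
    have "g(i := g i - 1) \<in> ?Q" using g(1) i by (force simp: PiE_iff extensional_def)
    then have "\<Phi> g \<le> \<Phi> (g(i := g i - 1))" by (rule g(2))
    also have "(\<lambda>i'. \<eta> * real ((g(i := g i - 1)) i')) = (\<lambda>i. \<eta> * real (g i))(i := \<eta> * real (g i) - \<eta>)"
      using i by (auto simp: fun_eq_iff algebra_simps of_nat_diff)
    then have "\<Phi> (g(i := g i - 1)) = smooth_dual m n A b c \<delta> ((\<lambda>i. \<eta> * real (g i))(i := \<eta> * real (g i) - \<eta>))"
      by (simp only: \<Phi>_def)
    finally show "smooth_dual m n A b c \<delta> (\<lambda>i. \<eta> * real (g i)) \<le> smooth_dual m n A b c \<delta> ((\<lambda>i. \<eta> * real (g i))(i := \<eta> * real (g i) - \<eta>))"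
      by (simp only: \<Phi>_def)
  qed
qed

subsection \<open>Exponential moments over the columns\<close>

abbreviation (input) exp_law :: "real measure"
  where "exp_law \<equiv> density lborel (\<lambda>x. ennreal (exponential_density 1 x))"

abbreviation (input) entry_law :: "nat \<Rightarrow> nat measure"
  where "entry_law k \<equiv> measure_pmf (pmf_of_set {1..k})"

abbreviation (input) matrix_law :: "nat \<Rightarrow> nat \<Rightarrow> nat \<Rightarrow> (nat \<times> nat \<Rightarrow> nat) measure"
  where "matrix_law m n k \<equiv> \<Pi>\<^sub>M ij\<in>{..<m} \<times> {..<n}. entry_law k"

section \<open>Measurability on the space of instances\<close>

lemma prob_space_exp_law: "prob_space exp_law"
  by (rule prob_space_exponential_density) simp

text \<open>A finite product of countable discrete spaces is discrete, so the matrix component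
  imposes no measurability condition.\<close>

lemma sets_PiM_pmf:
  fixes p :: "'i \<Rightarrow> 'a::countable pmf"
  assumes "finite I"
  shows "sets (\<Pi>\<^sub>M i\<in>I. measure_pmf (p i)) = sets (count_space (I \<rightarrow>\<^sub>E UNIV))"
proof -
  have "sets (\<Pi>\<^sub>M i\<in>I. measure_pmf (p i)) = sets (\<Pi>\<^sub>M i\<in>I. count_space (UNIV :: 'a set))"
    by (intro sets_PiM_cong) auto
  also have "\<dots> = sets (count_space (I \<rightarrow>\<^sub>E UNIV))"
    using assms by (subst count_space_PiM_finite) auto
  finally show ?thesis .
qed

lemma borel_measurable_PiM_pmf:
  fixes p :: "'i \<Rightarrow> 'a::countable pmf"
  assumes "finite I"
  shows "f \<in> borel_measurable (\<Pi>\<^sub>M i\<in>I. measure_pmf (p i))"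
  by (subst measurable_cong_sets[OF sets_PiM_pmf[OF assms] refl]) simp

lemma sets_instance_law:
  "sets (instance_law m n k) = sets (count_space ({..<m} \<times> {..<n} \<rightarrow>\<^sub>E (UNIV :: nat set)) \<Otimes>\<^sub>M (\<Pi>\<^sub>M j\<in>{..<n}. exp_law))"
  unfolding instance_law_def
  by (intro sets_pair_measure_cong refl sets_PiM_pmf) auto

text \<open>The matrix takes countably many values, so it is enough that each section in
  \<open>c\<close> is measurable.\<close>

lemma borel_measurable_instance_law:
  assumes "\<And>A. (\<lambda>c. f (A, c)) \<in> borel_measurable (\<Pi>\<^sub>M j\<in>{..<n}. exp_law)"
  shows "f \<in> borel_measurable (instance_law m n k)"
proof -
  have "f \<in> borel_measurable (count_space ({..<m} \<times> {..<n} \<rightarrow>\<^sub>E (UNIV :: nat set)) \<Otimes>\<^sub>M (\<Pi>\<^sub>M j\<in>{..<n}. exp_law))"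
    using assms by (intro measurable_pair_measure_countable1 countable_PiE) auto
  then show ?thesis
    using measurable_cong_sets[OF sets_instance_law refl] by blast
qed

lemma borel_measurable_column_sum:
  assumes "\<And>a. \<phi> a \<in> borel_measurable borel"
  shows "(\<lambda>(A, c). \<Sum>j<n. \<phi> (\<lambda>i. A (i, j)) (c j) :: real) \<in> borel_measurable (instance_law m n k)"
proof (rule borel_measurable_instance_law)
  fix A :: "nat \<times> nat \<Rightarrow> nat"
  have "(\<lambda>c. \<phi> (\<lambda>i. A (i, j)) (c j)) \<in> borel_measurable (\<Pi>\<^sub>M j\<in>{..<n}. exp_law)" if "j < n" for j
  proof (rule measurable_compose[OF _ assms])
    show "(\<lambda>c. c j) \<in> borel_measurable (\<Pi>\<^sub>M j\<in>{..<n}. exp_law)"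
      using measurable_component_singleton[of j "{..<n}" "\<lambda>_. exp_law"] that
      by (simp cong: measurable_cong_sets)
  qed
  then show "(\<lambda>c. case (A, c) of (A, c) \<Rightarrow> \<Sum>j<n. \<phi> (\<lambda>i. A (i, j)) (c j)) \<in> borel_measurable (\<Pi>\<^sub>M j\<in>{..<n}. exp_law)"
    by auto
qed

lemma sets_column_tail:
  assumes "\<And>a. \<phi> a \<in> borel_measurable borel"
  shows "{(A, c) \<in> space (instance_law m n k). (L::real) \<le> (\<Sum>j<n. \<phi> (\<lambda>i. A (i, j)) (c j))} \<in> sets (instance_law m n k)"
proof -
  have "{w \<in> space (instance_law m n k). L \<le> (\<lambda>(A, c). \<Sum>j<n. \<phi> (\<lambda>i. A (i, j)) (c j)) w} \<in> sets (instance_law m n k)"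
    using borel_measurable_column_sum[OF assms, where n = n and m = m and k = k] by measurable
  also have "{w \<in> space (instance_law m n k). L \<le> (\<lambda>(A, c). \<Sum>j<n. \<phi> (\<lambda>i. A (i, j)) (c j)) w} =
    {(A, c) \<in> space (instance_law m n k). L \<le> (\<Sum>j<n. \<phi> (\<lambda>i. A (i, j)) (c j))}" by auto
  finally show ?thesis .
qed

section \<open>Chernoff bounds for sums over the columns\<close>

text \<open>Markov's inequality for the exponential of the sum. For fixed \<open>A\<close> the costs
  are independent, so the inner integral factors over the columns. The integral over
  \<open>A\<close> is kept because the bound for squared sines needs an average over the
  entries.\<close>

lemma column_tail_le:
  assumes \<phi>: "\<And>a. \<phi> a \<in> borel_measurable borel"
  shows "emeasure (instance_law m n k) {(A, c) \<in> space (instance_law m n k). (L::real) \<le> (\<Sum>j<n. \<phi> (\<lambda>i. A (i, j)) (c j))}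
    \<le> ennreal (exp (- L)) * (\<integral>\<^sup>+A. (\<Prod>j<n. \<integral>\<^sup>+x. ennreal (exp (\<phi> (\<lambda>i. A (i, j)) x)) \<partial>exp_law) \<partial>matrix_law m n k)"
proof -
  let ?I = "instance_law m n k" and ?C = "\<Pi>\<^sub>M j\<in>{..<n}. exp_law"
  define F where "F = (\<lambda>(A, c). \<Sum>j<n. \<phi> (\<lambda>i. A (i, j)) (c j))"
  interpret E: prob_space exp_law by (rule prob_space_exp_law)
  interpret C: product_sigma_finite "\<lambda>_::nat. exp_law" by standard
  interpret CP: prob_space ?C by (intro prob_space_PiM E.prob_space_axioms)
  have F: "F \<in> borel_measurable ?I" unfolding F_def by (rule borel_measurable_column_sum[OF \<phi>])
  have eF: "(\<lambda>w. ennreal (exp (F w))) \<in> borel_measurable ?I" using F by measurable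
  have "{(A, c) \<in> space ?I. L \<le> (\<Sum>j<n. \<phi> (\<lambda>i. A (i, j)) (c j))} =
    {w \<in> space ?I. 1 \<le> ennreal (exp (- L)) * ennreal (exp (F w))}"
    by (auto simp: F_def ennreal_mult[symmetric] exp_add[symmetric] ennreal_ge_1)
  then have "emeasure ?I {(A, c) \<in> space ?I. L \<le> (\<Sum>j<n. \<phi> (\<lambda>i. A (i, j)) (c j))}
    \<le> ennreal (exp (- L)) * (\<integral>\<^sup>+w. ennreal (exp (F w)) * indicator (space ?I) w \<partial>?I)"
    using nn_integral_Markov_inequality[of "\<lambda>w. ennreal (exp (F w))" "space ?I" ?I "ennreal (exp (- L))"] eF
    by simp
  also have "(\<integral>\<^sup>+w. ennreal (exp (F w)) * indicator (space ?I) w \<partial>?I) = (\<integral>\<^sup>+w. ennreal (exp (F w)) \<partial>?I)"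
    by (intro nn_integral_cong) simp
  also have "\<dots> = (\<integral>\<^sup>+A. \<integral>\<^sup>+c. ennreal (exp (F (A, c))) \<partial>?C \<partial>matrix_law m n k)"
    using eF unfolding instance_law_def by (subst CP.nn_integral_fst) auto
  also have "\<dots> = (\<integral>\<^sup>+A. (\<Prod>j<n. \<integral>\<^sup>+x. ennreal (exp (\<phi> (\<lambda>i. A (i, j)) x)) \<partial>exp_law) \<partial>matrix_law m n k)"
  proof (rule nn_integral_cong)
    fix A :: "nat \<times> nat \<Rightarrow> nat"
    have "(\<integral>\<^sup>+c. ennreal (exp (F (A, c))) \<partial>?C) = (\<integral>\<^sup>+c. (\<Prod>j<n. ennreal (exp (\<phi> (\<lambda>i. A (i, j)) (c j)))) \<partial>?C)"
      by (intro nn_integral_cong) (simp add: F_def exp_sum prod_ennreal)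
    also have "\<dots> = (\<Prod>j<n. \<integral>\<^sup>+x. ennreal (exp (\<phi> (\<lambda>i. A (i, j)) x)) \<partial>exp_law)"
      using \<phi> by (intro C.product_nn_integral_prod) auto
    finally show "(\<integral>\<^sup>+c. ennreal (exp (F (A, c))) \<partial>?C) = (\<Prod>j<n. \<integral>\<^sup>+x. ennreal (exp (\<phi> (\<lambda>i. A (i, j)) x)) \<partial>exp_law)" .
  qed
  finally show ?thesis .
qed

lemma prob_space_matrix_law: "prob_space (matrix_law m n k)"
  by (intro prob_space_PiM measure_pmf.prob_space_axioms)

lemma column_tail_le_const:
  assumes \<phi>: "\<And>a. \<phi> a \<in> borel_measurable borel" and B: "0 \<le> B"
    "\<And>a. (\<integral>\<^sup>+x. ennreal (exp (\<phi> a x)) \<partial>exp_law) \<le> ennreal B"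
  shows "measure (instance_law m n k) {(A, c) \<in> space (instance_law m n k). (L::real) \<le> (\<Sum>j<n. \<phi> (\<lambda>i. A (i, j)) (c j))}
    \<le> exp (- L) * B ^ n"
proof -
  interpret I: prob_space "instance_law m n k" by (rule prob_space_instance_law)
  interpret A: prob_space "matrix_law m n k" by (rule prob_space_matrix_law)
  let ?S = "{(A, c) \<in> space (instance_law m n k). L \<le> (\<Sum>j<n. \<phi> (\<lambda>i. A (i, j)) (c j))}"
  have "emeasure (instance_law m n k) ?S
    \<le> ennreal (exp (- L)) * (\<integral>\<^sup>+A. (\<Prod>j<n. \<integral>\<^sup>+x. ennreal (exp (\<phi> (\<lambda>i. A (i, j)) x)) \<partial>exp_law) \<partial>matrix_law m n k)"
    by (rule column_tail_le[OF \<phi>])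
  also have "\<dots> \<le> ennreal (exp (- L)) * (\<integral>\<^sup>+A. (\<Prod>j<n. ennreal B) \<partial>matrix_law m n k)"
    by (intro mult_left_mono nn_integral_mono prod_mono_ennreal B(2) zero_le)
  also have "\<dots> = ennreal (exp (- L) * B ^ n)"
    using B by (simp add: A.emeasure_space_1 ennreal_power ennreal_mult del: One_nat_def)
  finally show ?thesis
    using B by (simp add: I.emeasure_eq_measure ennreal_le_iff)
qed

section \<open>Interval probabilities and moments of the exponential law\<close>

lemma emeasure_exp_law_le:
  assumes "S \<in> sets borel"
  shows "emeasure exp_law S \<le> emeasure lborel S"
proof -
  have "emeasure exp_law S = (\<integral>\<^sup>+x. ennreal (exponential_density 1 x) * indicator S x \<partial>lborel)"
    using assms by (intro emeasure_density) auto
  also have "\<dots> \<le> (\<integral>\<^sup>+x. indicator S x \<partial>lborel)"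
    by (intro nn_integral_mono) (auto simp: exponential_density_def indicator_def)
  finally show ?thesis using assms by simp
qed

lemma measure_exp_law_Icc_le:
  assumes "a \<le> b"
  shows "measure exp_law {a..b} \<le> b - a"
proof -
  interpret E: prob_space exp_law by (rule prob_space_exp_law)
  show ?thesis using emeasure_exp_law_le[of "{a..b}"] assms
    by (simp add: E.emeasure_eq_measure)
qed

text \<open>The density is smallest at the right end, and \<open>0 \<le> a\<close> keeps the
  interval inside its support.\<close>

lemma measure_exp_law_Icc_ge:
  assumes "0 \<le> a" "a \<le> b"
  shows "exp (- b) * (b - a) \<le> measure exp_law {a..b}"
proof -
  interpret E: prob_space exp_law by (rule prob_space_exp_law)
  have "ennreal (exp (- b) * (b - a)) = (\<integral>\<^sup>+x. ennreal (exp (- b)) * indicator {a..b} x \<partial>lborel)"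
    using assms by (simp add: nn_integral_cmult_indicator ennreal_mult)
  also have "\<dots> \<le> (\<integral>\<^sup>+x. ennreal (exponential_density 1 x) * indicator {a..b} x \<partial>lborel)"
    using assms by (intro nn_integral_mono) (auto simp: exponential_density_def indicator_def intro!: ennreal_leI)
  also have "\<dots> = emeasure exp_law {a..b}"
    by (intro emeasure_density[symmetric]) auto
  finally show ?thesis by (simp add: E.emeasure_eq_measure)
qed

lemma nn_integral_exp_indicator:
  fixes \<tau> :: real
  assumes "S \<in> sets borel"
  shows "(\<integral>\<^sup>+x. ennreal (exp (\<tau> * of_bool (x \<in> S))) \<partial>exp_law) = ennreal (1 + (exp \<tau> - 1) * measure exp_law S)"
proof -
  interpret E: prob_space exp_law by (rule prob_space_exp_law)
  have S: "S \<in> sets exp_law" using assms by simp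
  have i: "integrable exp_law (\<lambda>x. (exp \<tau> - 1) * indicator S x)"
    using S E.emeasure_finite[of S] by (intro integrable_mult_right integrable_real_indicator)
      (auto simp: less_top[symmetric])
  have eq: "exp (\<tau> * of_bool (x \<in> S)) = 1 + (exp \<tau> - 1) * indicator S x" for x by simp
  have "(\<integral>\<^sup>+x. ennreal (exp (\<tau> * of_bool (x \<in> S))) \<partial>exp_law) = ennreal (\<integral>x. 1 + (exp \<tau> - 1) * indicator S x \<partial>exp_law)"
    unfolding eq
  proof (intro nn_integral_eq_integral AE_I2)
    show "integrable exp_law (\<lambda>x. 1 + (exp \<tau> - 1) * indicator S x)" using i by simp
    show "0 \<le> 1 + (exp \<tau> - 1) * indicator S x" for x by (simp flip: eq)
  qed
  also have "(\<integral>x. 1 + (exp \<tau> - 1) * indicator S x \<partial>exp_law) = 1 + (exp \<tau> - 1) * measure exp_law S"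
    using i S E.prob_space by (subst Bochner_Integration.integral_add) auto
  finally show ?thesis .
qed

text \<open>Tilting the density of rate 1 by \<open>exp (x / 2)\<close> gives twice the density of
  rate 1/2.\<close>

lemma nn_integral_exp_half_abs: "(\<integral>\<^sup>+x. ennreal (exp (\<bar>x\<bar> / 2)) \<partial>exp_law) = 2"
proof -
  have "(\<integral>\<^sup>+x. ennreal (exp (\<bar>x\<bar> / 2)) \<partial>exp_law) = (\<integral>\<^sup>+x. ennreal (exponential_density 1 x) * ennreal (exp (\<bar>x\<bar> / 2)) \<partial>lborel)"
    by (intro nn_integral_density) auto
  also have "\<dots> = (\<integral>\<^sup>+x. 2 * ennreal (exponential_density (1/2) x) \<partial>lborel)"
    by (intro nn_integral_cong)
      (auto simp: exponential_density_def ennreal_mult[symmetric] exp_add[symmetric] simp flip: ennreal_numeral)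
  also have "\<dots> = 2 * emeasure (density lborel (\<lambda>x. ennreal (exponential_density (1/2) x))) UNIV"
    by (subst nn_integral_cmult) (auto simp: emeasure_density)
  also have "\<dots> = 2"
    using prob_space.emeasure_space_1[OF prob_space_exponential_density[of "1/2"]] by simp
  finally show ?thesis .
qed

lemma sum_abs_cost_tail:
  "measure (instance_law m n k) {(A, c) \<in> space (instance_law m n k). 4 * real n \<le> (\<Sum>j<n. \<bar>c j\<bar>)} \<le> exp (- real n)"
proof -
  have "measure (instance_law m n k) {(A, c) \<in> space (instance_law m n k). 2 * real n \<le> (\<Sum>j<n. \<bar>c j\<bar> / 2)} \<le> exp (- (2 * real n)) * 2 ^ n"
    using column_tail_le_const[of "\<lambda>_ x. \<bar>x\<bar> / 2" 2 m n k "2 * real n"] by (simp add: nn_integral_exp_half_abs)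
  also have "\<dots> \<le> exp (- (2 * real n)) * exp 1 ^ n"
    using exp_ge_add_one_self[of 1] by (intro mult_left_mono power_mono) auto
  also have "\<dots> = exp (- real n)" by (simp flip: exp_of_nat_mult exp_add)
  also have "{(A, c) \<in> space (instance_law m n k). 2 * real n \<le> (\<Sum>j<n. \<bar>c j\<bar> / 2)} =
     {(A, c) \<in> space (instance_law m n k). 4 * real n \<le> (\<Sum>j<n. \<bar>c j\<bar>)}"
    by (auto simp: sum_divide_distrib[symmetric])
  finally show ?thesis .
qed

text \<open>The set may depend on the column, but for fixed \<open>A\<close> the indicators are
  independent with success probability at most \<open>p\<close>, and each moment is at most
  \<open>exp ((exp \<tau> - 1) * p)\<close>. The parameter \<tau> is free: it will be 1 for windows
  and \<open>ln n\<close> for kinks.\<close>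

lemma column_count_tail:
  fixes p \<tau> L :: real
  assumes S: "\<And>a. S a \<in> sets borel" "\<And>a. measure exp_law (S a) \<le> p" and \<tau>: "0 \<le> \<tau>"
  shows "measure (instance_law m n k) {(A, c) \<in> space (instance_law m n k). L \<le> real (card {j. j < n \<and> c j \<in> S (\<lambda>i. A (i, j))})}
    \<le> exp (real n * ((exp \<tau> - 1) * p) - \<tau> * L)"
\<comment> \<open>At 0 the bound is 1. The scaled event used below agrees with the original one only
  for positive \<tau>.\<close>
proof (cases "\<tau> = 0")
  case True
  interpret I: prob_space "instance_law m n k" by (rule prob_space_instance_law)
  show ?thesis using True by simp
next
  case False
  then have pos: "0 < \<tau>" using \<tau> by simp
  have p: "0 \<le> p" using S(2)[of undefined] measure_nonneg order_trans by blast
  have "measure (instance_law m n k) {(A, c) \<in> space (instance_law m n k). \<tau> * L \<le> (\<Sum>j<n. \<tau> * of_bool (c j \<in> S (\<lambda>i. A (i, j))))}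
    \<le> exp (- (\<tau> * L)) * exp ((exp \<tau> - 1) * p) ^ n"
  proof (rule column_tail_le_const)
    show "(\<lambda>x. \<tau> * of_bool (x \<in> S a)) \<in> borel_measurable borel" for a
      using S(1)[of a] by (simp add: of_bool_def)
    fix a
    have "1 + (exp \<tau> - 1) * measure exp_law (S a) \<le> 1 + (exp \<tau> - 1) * p"
      using \<tau> S(2) by (intro add_left_mono mult_left_mono) auto
    also have "\<dots> \<le> exp ((exp \<tau> - 1) * p)" by (rule exp_ge_add_one_self)
    finally show "(\<integral>\<^sup>+x. ennreal (exp (\<tau> * of_bool (x \<in> S a))) \<partial>exp_law) \<le> ennreal (exp ((exp \<tau> - 1) * p))"
      unfolding nn_integral_exp_indicator[OF S(1)] by (rule ennreal_leI)
  qed simp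
  also have "\<dots> = exp (real n * ((exp \<tau> - 1) * p) - \<tau> * L)"
    by (simp add: exp_diff exp_minus divide_inverse mult.commute flip: exp_of_nat_mult)
  also have "{(A, c) \<in> space (instance_law m n k). \<tau> * L \<le> (\<Sum>j<n. \<tau> * of_bool (c j \<in> S (\<lambda>i. A (i, j))))} =
    {(A, c) \<in> space (instance_law m n k). L \<le> real (card {j. j < n \<and> c j \<in> S (\<lambda>i. A (i, j))})}"
    using pos by (auto simp: sum_distrib_left[symmetric] of_bool_def sum.If_cases Int_def)
  finally show ?thesis .
qed

section \<open>Averages over the matrix entries\<close>

lemma nn_integral_entry_law:
  assumes "k \<ge> 1" "\<And>a. a \<in> {1..k} \<Longrightarrow> 0 \<le> f a"
  shows "(\<integral>\<^sup>+a. ennreal (f a) \<partial>entry_law k) = ennreal ((\<Sum>a=1..k. f a) / real k)"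
proof -
  have "(\<integral>\<^sup>+a. ennreal (f a) \<partial>entry_law k) = (\<Sum>a=1..k. ennreal (f a)) / ennreal (real k)"
    using assms(1) by (subst nn_integral_pmf_of_set) (auto simp: ennreal_of_nat_eq_real_of_nat)
  also have "(\<Sum>a=1..k. ennreal (f a)) = ennreal (\<Sum>a=1..k. f a)"
    by (rule sum_ennreal) (rule assms(2))
  also have "ennreal (\<Sum>a=1..k. f a) / ennreal (real k) = ennreal ((\<Sum>a=1..k. f a) / real k)"
    using assms by (intro divide_ennreal sum_nonneg) auto
  finally show ?thesis .
qed

text \<open>Freeze all rows except \<open>i0\<close>. In column \<open>j\<close> they contribute
  only a phase, and the entries of row \<open>i0\<close> remain independent. The average of the
  squared sine over one entry is bounded below uniformly in the phase, so integrating row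
  \<open>i0\<close> gives one factor per column.\<close>

lemma nn_integral_matrix_law_sin_squared_le:
  fixes \<theta> :: "nat \<Rightarrow> real" and \<kappa> \<rho> :: real
  assumes k: "k \<ge> 2" and i0: "i0 < m" and \<kappa>: "0 \<le> \<kappa>" "\<kappa> \<le> 1"
    and \<rho>: "0 \<le> \<rho>" "\<rho> \<le> \<bar>\<theta> i0\<bar>" "k * \<rho> \<le> 3/4" and \<theta>: "\<bar>\<theta> i0\<bar> \<le> 1/2"
  shows "(\<integral>\<^sup>+A. (\<Prod>j<n. ennreal (1 - \<kappa> * (sin (pi * (\<Sum>i<m. \<theta> i * real (A (i, j)))))\<^sup>2)) \<partial>matrix_law m n k)
    \<le> ennreal (1 - \<kappa> * ((k * \<rho>)\<^sup>2 / 72)) ^ n"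
proof -
  let ?M = "\<lambda>_ :: nat \<times> nat. entry_law k"
  let ?J = "{i0} \<times> {..<n}" and ?I = "({..<m} - {i0}) \<times> {..<n}"
  let ?B = "ennreal (1 - \<kappa> * ((k * \<rho>)\<^sup>2 / 72))"
  interpret P: product_sigma_finite ?M
    by standard (rule sigma_finite_measure.sigma_finite_countable, rule prob_space_imp_sigma_finite, rule measure_pmf.prob_space_axioms)
  interpret I: prob_space "\<Pi>\<^sub>M ij\<in>?I. entry_law k"
    by (intro prob_space_PiM measure_pmf.prob_space_axioms)
  define F where "F A = (\<Prod>j<n. ennreal (1 - \<kappa> * (sin (pi * (\<Sum>i<m. \<theta> i * real (A (i, j)))))\<^sup>2))" for A :: "nat \<times> nat \<Rightarrow> nat"
  have IJ: "{..<m} \<times> {..<n} = ?I \<union> ?J" using i0 by auto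
  have F: "F \<in> borel_measurable (Pi\<^sub>M (?I \<union> ?J) ?M)"
    by (rule borel_measurable_PiM_pmf) auto
  have entry: "(\<integral>\<^sup>+a. ennreal (1 - \<kappa> * (sin (pi * (\<theta> i0 * real a + \<phi>)))\<^sup>2) \<partial>entry_law k) \<le> ?B" for \<phi>
  proof -
    let ?s = "\<lambda>a. (sin (pi * (\<theta> i0 * real a + \<phi>)))\<^sup>2"
    have s1: "?s a \<le> 1" for a using abs_sin_le_one by (simp add: abs_square_le_1)
    have "0 \<le> 1 - \<kappa> * ?s a" for a using \<kappa> s1[of a] mult_mono[of \<kappa> 1 "?s a" 1] by simp
    then have "(\<integral>\<^sup>+a. ennreal (1 - \<kappa> * ?s a) \<partial>entry_law k) = ennreal ((\<Sum>a=1..k. 1 - \<kappa> * ?s a) / real k)"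
      using k by (intro nn_integral_entry_law) auto
    also have "(\<Sum>a=1..k. 1 - \<kappa> * ?s a) = real k - \<kappa> * (\<Sum>a=1..k. ?s a)"
      by (simp add: sum_subtractf sum_distrib_left)
    also have "(real k - \<kappa> * (\<Sum>a=1..k. ?s a)) / real k \<le> 1 - \<kappa> * ((k * \<rho>)\<^sup>2 / 72)"
    proof -
      have "\<kappa> * (real k * (k * \<rho>)\<^sup>2 / 72) \<le> \<kappa> * (\<Sum>a=1..k. ?s a)"
        using sum_sin_squared_ge[OF k \<rho> \<theta>] \<kappa> by (intro mult_left_mono) auto
      then show ?thesis using k by (simp add: field_simps)
    qed
    finally show ?thesis using ennreal_leI by simp
  qed
  have "(\<integral>\<^sup>+A. F A \<partial>Pi\<^sub>M (?I \<union> ?J) ?M) = (\<integral>\<^sup>+x. \<integral>\<^sup>+y. F (merge ?I ?J (x, y)) \<partial>Pi\<^sub>M ?J ?M \<partial>Pi\<^sub>M ?I ?M)"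
    using F by (intro P.product_nn_integral_fold) auto
  also have "\<dots> \<le> (\<integral>\<^sup>+x. ?B ^ n \<partial>Pi\<^sub>M ?I ?M)"
  proof (rule nn_integral_mono)
    fix x :: "nat \<times> nat \<Rightarrow> nat"
    define \<phi> where "\<phi> j = (\<Sum>i\<in>{..<m} - {i0}. \<theta> i * real (x (i, j)))" for j
    define h where "h ij a = ennreal (1 - \<kappa> * (sin (pi * (\<theta> i0 * real a + \<phi> (snd ij))))\<^sup>2)" for ij :: "nat \<times> nat" and a :: nat
    have lin: "(\<Sum>i<m. \<theta> i * real (merge ?I ?J (x, y) (i, j))) = \<theta> i0 * real (y (i0, j)) + \<phi> j" if "j < n" for y j
    proof -
      have "(\<Sum>i<m. \<theta> i * real (merge ?I ?J (x, y) (i, j))) =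
        \<theta> i0 * real (merge ?I ?J (x, y) (i0, j)) + (\<Sum>i\<in>{..<m} - {i0}. \<theta> i * real (merge ?I ?J (x, y) (i, j)))"
        using i0 by (intro sum.remove) auto
      also have "(\<Sum>i\<in>{..<m} - {i0}. \<theta> i * real (merge ?I ?J (x, y) (i, j))) = \<phi> j"
        unfolding \<phi>_def using that by (intro sum.cong refl) (auto simp: merge_def)
      also have "merge ?I ?J (x, y) (i0, j) = y (i0, j)" using that by (simp add: merge_def)
      finally show ?thesis .
    qed
    have "F (merge ?I ?J (x, y)) = (\<Prod>ij\<in>?J. h ij (y ij))" for y
    proof -
      have "(\<Prod>ij\<in>?J. h ij (y ij)) = (\<Prod>ij\<in>Pair i0 ` {..<n}. h ij (y ij))"
        by (intro prod.cong) auto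
      also have "\<dots> = (\<Prod>j<n. h (i0, j) (y (i0, j)))"
        by (subst prod.reindex) (auto simp: inj_on_def)
      also have "\<dots> = F (merge ?I ?J (x, y))"
        unfolding F_def h_def using lin by (intro prod.cong refl) simp
      finally show ?thesis by simp
    qed
    then have "(\<integral>\<^sup>+y. F (merge ?I ?J (x, y)) \<partial>Pi\<^sub>M ?J ?M) = (\<integral>\<^sup>+y. (\<Prod>ij\<in>?J. h ij (y ij)) \<partial>Pi\<^sub>M ?J ?M)"
      by simp
    also have "\<dots> = (\<Prod>ij\<in>?J. \<integral>\<^sup>+a. h ij a \<partial>entry_law k)"
      by (intro P.product_nn_integral_prod) auto
    also have "\<dots> \<le> (\<Prod>ij\<in>?J. ?B)"
      unfolding h_def by (intro prod_mono_ennreal entry)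
    also have "\<dots> = ?B ^ n" by simp
    finally show "(\<integral>\<^sup>+y. F (merge ?I ?J (x, y)) \<partial>Pi\<^sub>M ?J ?M) \<le> ?B ^ n" .
  qed
  also have "\<dots> = ?B ^ n" by (simp add: I.emeasure_space_1 del: One_nat_def)
  finally show ?thesis unfolding F_def IJ .
qed

text \<open>The underlying space contains all arrays of natural numbers, so the range of the entries
  holds only almost everywhere, while the window and rounding estimates use it pointwise.\<close>

lemma AE_matrix_law:
  assumes "k \<ge> 1"
  shows "AE A in matrix_law m n k. \<forall>i<m. \<forall>j<n. A (i, j) \<in> {1..k}"
proof -
  have "AE A in matrix_law m n k. \<forall>ij\<in>{..<m} \<times> {..<n}. A ij \<in> {1..k}"
  proof (rule AE_finite_allI)
    fix ij :: "nat \<times> nat" assume ij: "ij \<in> {..<m} \<times> {..<n}"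
    show "AE A in matrix_law m n k. A ij \<in> {1..k}"
      using assms by (intro AE_PiM_component[OF _ ij] measure_pmf.prob_space_axioms) (auto simp: AE_measure_pmf_iff)
  qed auto
  then show ?thesis by (rule AE_mp) (auto intro!: AE_I2)
qed

lemma AE_instance_law:
  assumes "k \<ge> 1"
  shows "AE (A, c) in instance_law m n k. \<forall>i<m. \<forall>j<n. A (i, j) \<in> {1..k}"
proof -
  interpret A: prob_space "matrix_law m n k" by (rule prob_space_matrix_law)
  interpret C: prob_space "\<Pi>\<^sub>M j\<in>{..<n}. exp_law" by (intro prob_space_PiM prob_space_exp_law)
  interpret P: pair_sigma_finite "matrix_law m n k" "\<Pi>\<^sub>M j\<in>{..<n}. exp_law" ..
  have *: "{A \<in> space (matrix_law m n k). \<forall>i<m. \<forall>j<n. A (i, j) \<in> {1..k}} \<in> sets (matrix_law m n k)"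
    unfolding sets_PiM_pmf[OF finite_cartesian_product[OF finite_lessThan finite_lessThan]]
    by (auto simp: space_PiM)
  have "{w \<in> space (instance_law m n k). case w of (A, c) \<Rightarrow> \<forall>i<m. \<forall>j<n. A (i, j) \<in> {1..k}}
    = {A \<in> space (matrix_law m n k). \<forall>i<m. \<forall>j<n. A (i, j) \<in> {1..k}} \<times> space (\<Pi>\<^sub>M j\<in>{..<n}. exp_law)"
    by (auto simp: instance_law_def space_pair_measure)
  also have "\<dots> \<in> sets (instance_law m n k)"
    unfolding instance_law_def by (intro pair_measureI * sets.top)
  finally have "AE w in instance_law m n k. case w of (A, c) \<Rightarrow> \<forall>i<m. \<forall>j<n. A (i, j) \<in> {1..k}"
    unfolding instance_law_def
  proof (rule P.AE_pair_measure)
    show "AE A in matrix_law m n k. AE c in \<Pi>\<^sub>M j\<in>{..<n}. exp_law. case (A, c) of (A, c) \<Rightarrow> \<forall>i<m. \<forall>j<n. A (i, j) \<in> {1..k}"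
      using AE_matrix_law[OF assms] by (rule AE_mp) (intro AE_I2 impI, simp)
  qed
  then show ?thesis .
qed

section \<open>Lower tail of the squared sines over a window\<close>

text \<open>Makes the exponential moment linear in the squared sine, so that the average over the
  entries can be applied to it.\<close>

lemma exp_minus_le: 
  fixes y :: real
  assumes "0 \<le> y" "y \<le> 1"
  shows "exp (- y) \<le> 1 - y / 2"
proof -
  have "1 \<le> (1 - y / 2) * (1 + y)" using assms mult_mono[of y 1 y y] by (simp add: algebra_simps)
  also have "\<dots> \<le> (1 - y / 2) * exp y" using assms exp_ge_add_one_self[of y] by (intro mult_left_mono) auto
  finally have "1 * exp (- y) \<le> (1 - y / 2) * exp y * exp (- y)" by (intro mult_right_mono) auto
  then show ?thesis by (simp add: mult.assoc flip: exp_add)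
qed

text \<open>Given the matrix, membership in the window is a condition on \<open>c j\<close> alone,
  with an interval determined by column \<open>j\<close>. This keeps the columns
  independent.\<close>

lemma reduced_cost_abs_le_iff:
  "\<bar>reduced_cost m A c u j\<bar> \<le> d \<longleftrightarrow>
    c j \<in> {(\<Sum>i<m. u i * real (A (i, j))) - d..(\<Sum>i<m. u i * real (A (i, j))) + d}"
  by (auto simp: reduced_cost_def abs_le_iff)

text \<open>For a lower tail the negated sum is exponentiated. The centre of each window interval
  lies between 0 and \<open>U\<close>, so the window is hit with probability at least
  \<open>exp (- (U + 1)) * \<delta>\<close>; averaging over row \<open>i0\<close> supplies the mean
  squared sine.\<close>

lemma window_sin_squared_tail:
  fixes \<theta> u :: "nat \<Rightarrow> real" and \<rho> \<delta> U L :: real and m n k :: nat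
  assumes k: "k \<ge> 2" and i0: "i0 < m"
    and \<rho>: "0 \<le> \<rho>" "\<rho> \<le> \<bar>\<theta> i0\<bar>" "k * \<rho> \<le> 3/4" and \<theta>: "\<bar>\<theta> i0\<bar> \<le> 1/2"
    and \<delta>: "0 \<le> \<delta>" "\<delta> \<le> 1" and u: "\<And>i. i < m \<Longrightarrow> 0 \<le> u i" and U: "k * (\<Sum>i<m. u i) \<le> U"
  defines "E \<equiv> {(A, c) \<in> space (instance_law m n k).
      (\<Sum>j | j < n \<and> \<bar>reduced_cost m A c u j\<bar> \<le> \<delta>. (sin (pi * (\<Sum>i<m. \<theta> i * real (A (i, j)))))\<^sup>2) \<le> L}"
  shows "E \<in> sets (instance_law m n k)"
    and "measure (instance_law m n k) E \<le> exp (L - n * (exp (- (U + 1)) * \<delta> / 2 * ((k * \<rho>)\<^sup>2 / 72)))"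
proof -
  define v where "v a = (\<Sum>i<m. u i * real (a i))" for a :: "nat \<Rightarrow> nat"
  define s where "s a = (sin (pi * (\<Sum>i<m. \<theta> i * real (a i))))\<^sup>2" for a :: "nat \<Rightarrow> nat"
  define S where "S a = {v a - \<delta>..v a + \<delta>}" for a
  define \<phi> where "\<phi> a x = (- s a) * of_bool (x \<in> S a)" for a x
  \<comment> \<open>The lower bound for the window probability, times the 1/2 from
    \<open>exp_minus_le\<close>.\<close>
  define \<kappa> where "\<kappa> = exp (- (U + 1)) * \<delta> / 2"
  interpret I: prob_space "instance_law m n k" by (rule prob_space_instance_law)
  have s: "0 \<le> s a" "s a \<le> 1" for a
    using abs_sin_le_one by (auto simp: s_def abs_square_le_1)
  have \<phi>: "\<phi> a \<in> borel_measurable borel" for a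
    unfolding \<phi>_def S_def by (simp add: of_bool_def)
  have sum_eq: "(\<Sum>j | j < n \<and> \<bar>reduced_cost m A c u j\<bar> \<le> \<delta>. (sin (pi * (\<Sum>i<m. \<theta> i * real (A (i, j)))))\<^sup>2)
    = - (\<Sum>j<n. \<phi> (\<lambda>i. A (i, j)) (c j))" for A c
  proof -
    have "- (\<Sum>j<n. \<phi> (\<lambda>i. A (i, j)) (c j)) = (\<Sum>j<n. if \<bar>reduced_cost m A c u j\<bar> \<le> \<delta> then s (\<lambda>i. A (i, j)) else 0)"
      unfolding sum_negf[symmetric] reduced_cost_abs_le_iff
      by (intro sum.cong refl) (auto simp: \<phi>_def S_def v_def)
    also have "\<dots> = (\<Sum>j | j \<in> {..<n} \<and> \<bar>reduced_cost m A c u j\<bar> \<le> \<delta>. s (\<lambda>i. A (i, j)))"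
      by (intro sum.inter_filter[symmetric]) auto
    finally show ?thesis by (simp add: s_def)
  qed
  have E: "E = {(A, c) \<in> space (instance_law m n k). - L \<le> (\<Sum>j<n. \<phi> (\<lambda>i. A (i, j)) (c j))}"
    unfolding E_def sum_eq by auto
  show "E \<in> sets (instance_law m n k)" unfolding E by (rule sets_column_tail[OF \<phi>])
  have U0: "0 \<le> U" using u U by (meson mult_nonneg_nonneg of_nat_0_le_iff order_trans sum_nonneg lessThan_iff)
  have \<kappa>: "0 \<le> \<kappa>" "\<kappa> \<le> 1"
    using \<delta> U0 mult_mono[of "exp (- (U + 1))" 1 \<delta> 1] by (auto simp: \<kappa>_def)
  have inner: "(\<integral>\<^sup>+x. ennreal (exp (\<phi> a x)) \<partial>exp_law) \<le> ennreal (1 - \<kappa> * s a)"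
    if a: "\<forall>i<m. a i \<in> {1..k}" for a
  proof -
    interpret X: prob_space exp_law by (rule prob_space_exp_law)
    have v0: "0 \<le> v a" using u by (auto simp: v_def intro!: sum_nonneg)
    have "v a \<le> (\<Sum>i<m. u i * real k)" unfolding v_def using a u by (intro sum_mono mult_left_mono) auto
    then have vU: "v a \<le> U" using U by (simp add: sum_distrib_left mult.commute)
    \<comment> \<open>Only the right half of the interval is counted, since the left half may leave
      the support of the density.\<close>
    have "exp (- (U + 1)) * \<delta> \<le> exp (- (v a + \<delta>)) * ((v a + \<delta>) - v a)"
      using vU \<delta> by (intro mult_mono) auto
    also have "\<dots> \<le> measure exp_law {v a..v a + \<delta>}"
      using v0 \<delta> by (intro measure_exp_law_Icc_ge) auto
    also have "\<dots> \<le> measure exp_law (S a)"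
      using \<delta> by (intro X.finite_measure_mono) (auto simp: S_def)
    finally have P: "exp (- (U + 1)) * \<delta> \<le> measure exp_law (S a)" .
    have "1 + (exp (- s a) - 1) * measure exp_law (S a) \<le> 1 + (- (s a / 2)) * measure exp_law (S a)"
      using exp_minus_le[OF s(1)[of a] s(2)[of a]] by (intro add_left_mono mult_right_mono) auto
    also have "\<dots> \<le> 1 + (- (s a / 2)) * (exp (- (U + 1)) * \<delta>)"
      using P s[of a] by (intro add_left_mono mult_left_mono_neg) auto
    also have "\<dots> = 1 - \<kappa> * s a" by (simp add: \<kappa>_def)
    finally show ?thesis
      unfolding \<phi>_def by (subst nn_integral_exp_indicator) (auto simp: S_def intro!: ennreal_leI)
  qed
  have "emeasure (instance_law m n k) E \<le>
    ennreal (exp L) * (\<integral>\<^sup>+A. (\<Prod>j<n. \<integral>\<^sup>+x. ennreal (exp (\<phi> (\<lambda>i. A (i, j)) x)) \<partial>exp_law) \<partial>matrix_law m n k)"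
    unfolding E using column_tail_le[OF \<phi>, of m n k "- L"] by simp
  also have "\<dots> \<le> ennreal (exp L) * (\<integral>\<^sup>+A. (\<Prod>j<n. ennreal (1 - \<kappa> * (sin (pi * (\<Sum>i<m. \<theta> i * real (A (i, j)))))\<^sup>2)) \<partial>matrix_law m n k)"
  proof (intro mult_left_mono nn_integral_mono_AE)
    have "k \<ge> 1" using k by simp
    from AE_matrix_law[OF this, of m n]
    show "AE A in matrix_law m n k. (\<Prod>j<n. \<integral>\<^sup>+x. ennreal (exp (\<phi> (\<lambda>i. A (i, j)) x)) \<partial>exp_law)
      \<le> (\<Prod>j<n. ennreal (1 - \<kappa> * (sin (pi * (\<Sum>i<m. \<theta> i * real (A (i, j)))))\<^sup>2))"
    proof (rule AE_mp, intro AE_I2 impI prod_mono_ennreal)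
      fix A :: "nat \<times> nat \<Rightarrow> nat" and j
      assume "\<forall>i<m. \<forall>j<n. A (i, j) \<in> {1..k}" "j \<in> {..<n}"
      then show "(\<integral>\<^sup>+x. ennreal (exp (\<phi> (\<lambda>i. A (i, j)) x)) \<partial>exp_law)
        \<le> ennreal (1 - \<kappa> * (sin (pi * (\<Sum>i<m. \<theta> i * real (A (i, j)))))\<^sup>2)"
        using inner[of "\<lambda>i. A (i, j)"] by (simp add: s_def)
    qed
  qed simp
  also have "\<dots> \<le> ennreal (exp L) * ennreal (1 - \<kappa> * ((k * \<rho>)\<^sup>2 / 72)) ^ n"
    by (intro mult_left_mono nn_integral_matrix_law_sin_squared_le[where \<theta> = \<theta>, OF k i0 \<kappa> \<rho> \<theta>]) simp
  also have "\<dots> \<le> ennreal (exp L) * ennreal (exp (- (\<kappa> * ((k * \<rho>)\<^sup>2 / 72)))) ^ n"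
    using exp_ge_add_one_self[of "- (\<kappa> * ((k * \<rho>)\<^sup>2 / 72))"]
    by (intro mult_left_mono power_mono ennreal_leI) auto
  also have "\<dots> = ennreal (exp (L - n * (\<kappa> * ((k * \<rho>)\<^sup>2 / 72))))"
    by (simp add: ennreal_power ennreal_mult[symmetric] exp_of_nat_mult[symmetric] exp_add[symmetric])
  finally show "measure (instance_law m n k) E \<le> exp (L - n * (exp (- (U + 1)) * \<delta> / 2 * ((k * \<rho>)\<^sup>2 / 72)))"
    unfolding \<kappa>_def[symmetric] I.emeasure_eq_measure by (simp add: ennreal_le_iff)
qed

subsection \<open>The union bound\<close>

lemma measure_UN_le_card:
  assumes "finite_measure M" "finite I" "\<And>i. i \<in> I \<Longrightarrow> F i \<in> sets M" "\<And>i. i \<in> I \<Longrightarrow> measure M (F i) \<le> B"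
  shows "measure M (\<Union>i\<in>I. F i) \<le> real (card I) * B"
proof -
  have "measure M (\<Union>i\<in>I. F i) \<le> (\<Sum>i\<in>I. measure M (F i))"
    using assms by (intro measure_UNION_le) auto
  also have "\<dots> \<le> (\<Sum>i\<in>I. B)" using assms by (intro sum_mono) auto
  finally show ?thesis by simp
qed

lemma sets_column_count:
  assumes S: "\<And>a. S a \<in> sets borel"
  shows "{(A, c) \<in> space (instance_law m n k). (L::real) \<le> real (card {j. j < n \<and> c j \<in> S (\<lambda>i. A (i, j))})} \<in> sets (instance_law m n k)"
proof -
  have "(\<Sum>j<n. of_bool (c j \<in> S (\<lambda>i. A (i, j)))) = real (card {j. j < n \<and> c j \<in> S (\<lambda>i. A (i, j))})"
    for A :: "nat \<times> nat \<Rightarrow> nat" and c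
    by (auto simp: of_bool_def sum.If_cases Int_def)
  moreover have "(\<lambda>x. of_bool (x \<in> S a) :: real) \<in> borel_measurable borel" for a
    using S[of a] by (simp add: of_bool_def)
  ultimately show ?thesis
    using sets_column_tail[of "\<lambda>a x. of_bool (x \<in> S a)" m n k L] by simp
qed

context
  fixes m n k :: nat and u :: "nat \<Rightarrow> real"
begin

lemma window_count_tail:
  fixes \<delta> L :: real
  assumes \<delta>: "0 \<le> \<delta>"
  defines "E \<equiv> {(A, c) \<in> space (instance_law m n k). L \<le> real (card {j. j < n \<and> \<bar>reduced_cost m A c u j\<bar> \<le> \<delta>})}"
  shows "E \<in> sets (instance_law m n k)" and "measure (instance_law m n k) E \<le> exp (4 * real n * \<delta> - L)"
proof -
  define S where "S a = {(\<Sum>i<m. u i * real (a i)) - \<delta>..(\<Sum>i<m. u i * real (a i)) + \<delta>}" for a :: "nat \<Rightarrow> nat"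
  have E: "E = {(A, c) \<in> space (instance_law m n k). L \<le> real (card {j. j < n \<and> c j \<in> S (\<lambda>i. A (i, j))})}"
    unfolding E_def reduced_cost_abs_le_iff S_def ..
  show "E \<in> sets (instance_law m n k)" unfolding E by (rule sets_column_count) (simp add: S_def)
  \<comment> \<open>Here \<tau> is 1, and \<open>exp 1 - 1 \<le> 2\<close> gives the constant
    4.\<close>
  have "measure (instance_law m n k) E \<le> exp (real n * ((exp 1 - 1) * (2 * \<delta>)) - 1 * L)"
    unfolding E
  proof (rule column_count_tail)
    show "measure exp_law (S a) \<le> 2 * \<delta>" for a
      using measure_exp_law_Icc_le[of "(\<Sum>i<m. u i * real (a i)) - \<delta>" "(\<Sum>i<m. u i * real (a i)) + \<delta>"] \<delta>
      by (simp add: S_def)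
  qed (simp_all add: S_def)
  also have "\<dots> \<le> exp (real n * (2 * (2 * \<delta>)) - 1 * L)"
    using exp_le \<delta> by (simp only: exp_le_cancel_iff, intro diff_mono mult_left_mono mult_right_mono) auto
  finally show "measure (instance_law m n k) E \<le> exp (4 * real n * \<delta> - L)" by (simp add: mult_ac)
qed

text \<open>In the application the expected count is tiny, so a large \<tau> pays off: with
  \<open>\<tau> = ln n\<close> each unit of the threshold \<open>L\<close> gains a factor
  \<open>1 / n\<close>.\<close>

lemma kink_count_tail:
  fixes \<delta> \<epsilon> \<tau> L :: real
  assumes \<epsilon>: "0 \<le> \<epsilon>" and \<tau>: "0 \<le> \<tau>"
  defines "E \<equiv> {(A, c) \<in> space (instance_law m n k). L \<le> real (card {j. j < n \<and>
    (\<bar>reduced_cost m A c u j - \<delta>\<bar> \<le> \<epsilon> \<or> \<bar>reduced_cost m A c u j + \<delta>\<bar> \<le> \<epsilon>)})}"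
  shows "E \<in> sets (instance_law m n k)" and "measure (instance_law m n k) E \<le> exp (real n * ((exp \<tau> - 1) * (4 * \<epsilon>)) - \<tau> * L)"
proof -
  define v where "v a = (\<Sum>i<m. u i * real (a i))" for a :: "nat \<Rightarrow> nat"
  define S where "S a = {v a + \<delta> - \<epsilon>..v a + \<delta> + \<epsilon>} \<union> {v a - \<delta> - \<epsilon>..v a - \<delta> + \<epsilon>}" for a
  have "\<bar>reduced_cost m A c u j - \<delta>\<bar> \<le> \<epsilon> \<or> \<bar>reduced_cost m A c u j + \<delta>\<bar> \<le> \<epsilon> \<longleftrightarrow> c j \<in> S (\<lambda>i. A (i, j))" for A c j
    by (auto simp: reduced_cost_def S_def v_def abs_le_iff)
  then have E: "E = {(A, c) \<in> space (instance_law m n k). L \<le> real (card {j. j < n \<and> c j \<in> S (\<lambda>i. A (i, j))})}"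
    unfolding E_def by simp
  show "E \<in> sets (instance_law m n k)" unfolding E by (rule sets_column_count) (simp add: S_def)
  interpret X: prob_space exp_law by (rule prob_space_exp_law)
  show "measure (instance_law m n k) E \<le> exp (real n * ((exp \<tau> - 1) * (4 * \<epsilon>)) - \<tau> * L)"
    unfolding E
  proof (rule column_count_tail)
    fix a
    have "measure exp_law (S a) \<le> measure exp_law {v a + \<delta> - \<epsilon>..v a + \<delta> + \<epsilon>} + measure exp_law {v a - \<delta> - \<epsilon>..v a - \<delta> + \<epsilon>}"
      unfolding S_def by (rule measure_Un_le) auto
    also have "\<dots> \<le> (v a + \<delta> + \<epsilon> - (v a + \<delta> - \<epsilon>)) + (v a - \<delta> + \<epsilon> - (v a - \<delta> - \<epsilon>))"
      using \<epsilon> by (intro add_mono measure_exp_law_Icc_le) auto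
    finally show "measure exp_law (S a) \<le> 4 * \<epsilon>" by simp
  qed (simp_all add: S_def \<tau>)
qed

end

section \<open>Choice of parameters and failure events\<close>

text \<open>The failure events are overfull windows (\<open>E1\<close>), small sine sums
  (\<open>E2\<close>), too many columns at kinks (\<open>E3\<close>) and a large total cost
  (\<open>E4\<close>). The first three are controlled for all relevant fixed grid points at once, so
  outside them \<open>IPGAP_le_window\<close> applies at the random minimiser.\<close>

lemma IPGAP_tail:
  fixes m n k :: nat and \<beta> \<Delta> :: real and b :: "nat \<Rightarrow> real"
  assumes m: "m \<ge> 1" and k: "k \<ge> 3" and \<beta>: "0 < \<beta>"
  defines "\<Delta> \<equiv> 53084160 * real m ^ 5 * exp (5 / \<beta>)"
  assumes n: "4 * \<Delta>\<^sup>2 * k \<le> n"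
    and b: "\<And>i. i < m \<Longrightarrow> b i \<in> \<int>" "\<And>i. i < m \<Longrightarrow> real k * real n * \<beta> \<le> b i"
  shows "measure (instance_law m n k)
      {(A, c) \<in> space (instance_law m n k).
        19 * \<Delta>\<^sup>2 * (ln (real n))\<^sup>2 / real n \<le> IPGAP m n (\<lambda>i j. real (A (i, j))) b c}
    \<le> 1 / real n"
proof -
  let ?P = "instance_law m n k"
  interpret I: prob_space ?P by (rule prob_space_instance_law)
  define X where "X = real n"
  define l where "l = ln X"

  have m5: "real m \<le> real m ^ 5" using m by (intro self_le_power) auto
  have "1 + 5 / \<beta> \<le> exp (5 / \<beta>)" by (rule exp_ge_add_one_self)
  then have ex: "1 \<le> exp (5 / \<beta>)" "5 / \<beta> \<le> exp (5 / \<beta>)" using divide_pos_pos[of 5 \<beta>] \<beta> by linarith+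
  have "53084160 * real m * 1 \<le> \<Delta>" unfolding \<Delta>_def
    using m5 ex by (intro mult_mono) auto
  then have \<Delta>m: "53084160 * real m \<le> \<Delta>" by simp
  have "1 \<le> real m ^ 5" using m by simp
  then have "1 * (5 / \<beta>) \<le> \<Delta>" unfolding \<Delta>_def
    using \<beta> ex \<open>1 \<le> real m ^ 5\<close> by (intro mult_mono) auto
  then have \<Delta>\<beta>: "5 / \<beta> \<le> \<Delta>" by simp
  have \<Delta>1: "53084160 \<le> \<Delta>" using \<Delta>m m by simp
  have X4: "4 * \<Delta>\<^sup>2 \<le> X"
  proof -
    have "4 * \<Delta>\<^sup>2 * 1 \<le> 4 * \<Delta>\<^sup>2 * k" using k by (intro mult_left_mono) auto
    then show ?thesis using n by (simp add: X_def)
  qed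
  have \<Delta>X: "\<Delta> \<le> X"
  proof -
    have "1 * \<Delta> \<le> (4 * \<Delta>) * \<Delta>" using \<Delta>1 by (intro mult_right_mono) auto
    then show ?thesis using X4 by (simp add: power2_eq_square)
  qed
  have kX: "real k \<le> X"
  proof -
    have "1 * 1 \<le> \<Delta> * \<Delta>" using \<Delta>1 by (intro mult_mono) auto
    then have "1 * real k \<le> 4 * \<Delta>\<^sup>2 * k" by (intro mult_right_mono) (auto simp: power2_eq_square)
    then show ?thesis using n by (simp add: X_def)
  qed
  have X1: "53084160 \<le> X" using \<Delta>1 \<Delta>X by simp
  have Xm: "24 * real m \<le> X" using \<Delta>m \<Delta>X by simp
  have l1: "1 \<le> l"
  proof -
    have "exp 1 \<le> X" using exp_le X1 by linarith
    then show ?thesis using X1 by (simp add: l_def ln_ge_iff)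
  qed
  have expl: "exp l = X" using X1 by (simp add: l_def)
  have \<Delta>l: "\<Delta> * l \<le> X"
  proof -
    \<comment> \<open>A logarithm of order \<open>sqrt X\<close> is all that is needed, since
      \<open>4 * \<Delta>\<^sup>2 \<le> X\<close> bounds \<open>2 * \<Delta>\<close> by
      \<open>sqrt X\<close>. This gives \<open>\<delta> \<le> 1\<close> below.\<close>
    have "l = 2 * ln (sqrt X)" using X1 by (simp add: l_def ln_sqrt)
    also have "ln (sqrt X) \<le> sqrt X" using X1 by (intro less_imp_le ln_less_self) simp
    finally have "l \<le> 2 * sqrt X" by simp
    then have "\<Delta> * l \<le> \<Delta> * (2 * sqrt X)" using \<Delta>1 by (intro mult_left_mono) auto
    also have "\<dots> = (2 * \<Delta>) * sqrt X" by simp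
    also have "2 * \<Delta> \<le> sqrt X" using X4 by (intro real_le_rsqrt) (simp add: power_mult_distrib)
    then have "(2 * \<Delta>) * sqrt X \<le> sqrt X * sqrt X" using X1 by (intro mult_right_mono) auto
    finally show ?thesis using X1 by simp
  qed

  text \<open>
    \<open>\<delta>\<close> is the window width, \<open>\<eta>\<close> the mesh of the grid, \<open>K\<close> bounds the number of columns at a kink, \<open>L\<close>
    is the sum of squared sines which makes the \<open>(2H + 1)\<^sup>m\<close> frequencies beyond the radius \<open>\<rho>\<close>
    negligible. The factor \<open>53084160 = 20 * 16 * 72 * 48\<^sup>2\<close> of \<open>\<Delta>\<close> gives the moment bound for \<open>E2\<close>
    an exponent \<open>20 m ln n\<close>.
  \<close>
  define \<delta> where "\<delta> = \<Delta> * l / X"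
  define \<eta> where "\<eta> = 1 / X ^ 4"
  define K where "K = 12 * real m"
  define L where "L = 6 * m * l"
  define H where "H = n\<^sup>2"
  define \<rho> where "\<rho> = 1 / (4 * m * K * k)"
  define \<theta> where "\<theta> h i = (real (h i) - real H) / real (2 * H + 1)" for h :: "nat \<Rightarrow> nat" and i
  define u where "u g i = \<eta> * real (g i)" for g :: "nat \<Rightarrow> nat" and i
  \<comment> \<open>With mesh \<open>1 / X ^ 4\<close>, taking \<open>n ^ 6\<close> points per
    coordinate reaches multipliers up to about \<open>n\<^sup>2\<close>, beyond the budget of the
    minimiser.\<close>
  define Q where "Q = {..<m} \<rightarrow>\<^sub>E {..<n ^ 6}"
  \<comment> \<open>The budget guaranteed by \<open>grid_minimizer\<close>. It keeps the window
    probability at least of order \<open>exp (- 5 / \<beta>) * \<delta>\<close>, as the bound for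
    \<open>E2\<close> requires.\<close>
  define Q' where "Q' = {g \<in> Q. k * (\<Sum>i<m. u g i) \<le> 5 / \<beta>}"
  define Far where "Far = {h \<in> {..<m} \<rightarrow>\<^sub>E {..<2 * H + 1}. \<exists>i<m. \<rho> < \<bar>\<theta> h i\<bar>}"
  define E1 where "E1 g = {(A, c) \<in> space ?P. 9 * X * \<delta> \<le> real (card {j. j < n \<and> \<bar>reduced_cost m A c (u g) j\<bar> \<le> 2 * \<delta>})}" for g
  define E2 where "E2 g h = {(A, c) \<in> space ?P.
      (\<Sum>j | j < n \<and> \<bar>reduced_cost m A c (u g) j\<bar> \<le> \<delta> / 2. (sin (pi * (\<Sum>i<m. \<theta> h i * real (A (i, j)))))\<^sup>2) \<le> L}" for g h
  define E3 where "E3 g = {(A, c) \<in> space ?P. K \<le> real (card {j. j < n \<and>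
    (\<bar>reduced_cost m A c (u g) j - \<delta>\<bar> \<le> \<eta> * k \<or> \<bar>reduced_cost m A c (u g) j + \<delta>\<bar> \<le> \<eta> * k)})}" for g
  define E4 where "E4 = {(A, c) \<in> space ?P. 4 * real n \<le> (\<Sum>j<n. \<bar>c j\<bar>)}"

  have \<delta>: "0 < \<delta>" "\<delta> \<le> 1" and X\<delta>: "X * \<delta> = \<Delta> * l"
    using \<Delta>l \<Delta>1 l1 X1 by (auto simp: \<delta>_def field_simps)
  have \<eta>: "0 < \<eta>" using X1 by (simp add: \<eta>_def)
  have u0: "0 \<le> u g i" for g i using \<eta> by (simp add: u_def)
  have \<eta>k: "\<eta> * k \<le> 1 / X ^ 3"
  proof -
    have "\<eta> * k \<le> \<eta> * X" using \<eta> kX by (intro mult_left_mono) auto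
    then show ?thesis using X1 by (simp add: \<eta>_def power_eq_if)
  qed
  have pow: "X \<le> X ^ 2" "X ^ 2 \<le> X ^ 3" using X1 by (auto intro!: self_le_power power_increasing)
  have \<eta>k\<delta>: "\<eta> * k \<le> \<delta> / 2"
  proof -
    have "X \<le> X ^ 3" using pow by linarith
    then have "1 / X ^ 3 \<le> 1 / X" using X1 by (intro divide_left_mono) auto
    moreover have "2 * 1 \<le> \<Delta> * l" using \<Delta>1 l1 by (intro mult_mono) auto
    then have "2 / X \<le> \<delta>" unfolding \<delta>_def using X1 by (intro divide_right_mono) auto
    ultimately show ?thesis using \<eta>k by simp
  qed
  \<comment> \<open>The factor \<open>k\<close> cancels, so neither the exponent for
    \<open>E2\<close> nor \<Delta> depends on \<open>k\<close>.\<close>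
  have k\<rho>: "k * \<rho> = 1 / (48 * real m ^ 2)" using k m by (simp add: \<rho>_def K_def power2_eq_square)
  have k\<rho>': "k * \<rho> \<le> 3 / 4"
  proof -
    have "1 / (48 * real m ^ 2) \<le> 1 / (48 * 1)" using m by (intro divide_left_mono) auto
    then show ?thesis unfolding k\<rho> by simp
  qed
  have \<rho>0: "0 \<le> \<rho>" by (simp add: \<rho>_def K_def)
  have \<theta>_half: "\<bar>\<theta> h i\<bar> \<le> 1 / 2" if "h \<in> {..<m} \<rightarrow>\<^sub>E {..<2 * H + 1}" "i < m" for h i
  proof -
    have "h i < 2 * H + 1" using that by auto
    then have "\<bar>real (h i) - real H\<bar> \<le> real H" by linarith
    then show ?thesis by (simp add: \<theta>_def abs_divide field_simps)
  qed
  have M: "real (2 * H + 1) \<le> X ^ 3"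
  proof -
    have "real (2 * H + 1) = 2 * X\<^sup>2 + 1" by (simp add: H_def X_def)
    also have "\<dots> \<le> 3 * X\<^sup>2" using pow X1 by linarith
    also have "\<dots> \<le> X * X\<^sup>2" using X1 by (intro mult_right_mono) auto
    finally show ?thesis by (simp add: power_eq_if)
  qed
  have finQ: "finite Q" "finite Q'" "finite Far"
    by (auto simp: Q_def Q'_def Far_def intro!: finite_PiE)
  have exp_m: "exp (p * m * l) = (X ^ p) ^ m" for p :: nat
    by (simp add: mult.commute mult.left_commute flip: expl exp_of_nat_mult)
  have cardQ: "real (card Q) = exp (6 * m * l)"
    using exp_m[of 6] by (simp add: Q_def card_PiE X_def)
  have cardQ': "real (card Q') \<le> exp (6 * m * l)"
    unfolding cardQ[symmetric] using finQ by (auto simp: Q'_def intro!: card_mono)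
  have MM: "real (2 * H + 1) ^ m \<le> exp (3 * m * l)"
    using exp_m[of 3] power_mono[OF M, of m] by simp
  have cardFar: "real (card Far) \<le> exp (3 * m * l)"
  proof -
    have "card Far \<le> card ({..<m} \<rightarrow>\<^sub>E {..<2 * H + 1})"
      unfolding Far_def by (intro card_mono finite_PiE) auto
    also have "\<dots> = (2 * H + 1) ^ m" by (simp add: card_PiE)
    finally have "real (card Far) \<le> real (2 * H + 1) ^ m" by (metis of_nat_le_iff of_nat_power)
    then show ?thesis using MM by linarith
  qed
  have ml: "l \<le> m * l" using m l1 by simp

  have E1: "E1 g \<in> sets ?P" "measure ?P (E1 g) \<le> exp (- (11 * m * l))" for g
  proof -
    have d: "0 \<le> 2 * \<delta>" using \<delta> by simp
    show "E1 g \<in> sets ?P" unfolding E1_def by (rule window_count_tail(1)[OF d])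
    have "measure ?P (E1 g) \<le> exp (4 * real n * (2 * \<delta>) - 9 * X * \<delta>)"
      unfolding E1_def by (rule window_count_tail(2)[OF d])
    \<comment> \<open>The threshold 9 against 8 leaves one
      \<open>X * \<delta> = \<Delta> * l\<close>, which dominates the \<open>6 * m * l\<close> from
      the number of grid points.\<close>
    also have "4 * real n * (2 * \<delta>) - 9 * X * \<delta> = - (\<Delta> * l)" unfolding X\<delta>[symmetric] by (simp add: X_def)
    also have "exp (- (\<Delta> * l)) \<le> exp (- (11 * m * l))"
      using \<Delta>m l1 by (simp add: mult_right_mono)
    finally show "measure ?P (E1 g) \<le> exp (- (11 * m * l))" .
  qed
  have B1: "measure ?P (\<Union>g\<in>Q. E1 g) \<le> exp (- 5 * l)"
  proof -
    have "measure ?P (\<Union>g\<in>Q. E1 g) \<le> real (card Q) * exp (- (11 * m * l))"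
      using finQ E1 by (intro measure_UN_le_card I.finite_measure_axioms)
    also have "\<dots> = exp (- (5 * (m * l)))" unfolding cardQ by (simp flip: exp_add)
    also have "\<dots> \<le> exp (- 5 * l)" using ml by simp
    finally show ?thesis .
  qed

  have E3: "E3 g \<in> sets ?P" "measure ?P (E3 g) \<le> exp (1 - 12 * m * l)" for g
  proof -
    have e: "0 \<le> \<eta> * k" and l0: "0 \<le> l" using \<eta> l1 by simp_all
    show "E3 g \<in> sets ?P" unfolding E3_def by (rule kink_count_tail(1)[OF e l0])
    \<comment> \<open>With \<open>\<tau> = l\<close> the mean term is at most \<open>4 / X\<close>,
      while the threshold \<open>K = 12 * m\<close> contributes \<open>- 12 * m * l\<close>.\<close>
    have "measure ?P (E3 g) \<le> exp (real n * ((exp l - 1) * (4 * (\<eta> * k))) - l * K)"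
      unfolding E3_def by (rule kink_count_tail(2)[OF e l0])
    also have "real n * ((exp l - 1) * (4 * (\<eta> * k))) \<le> X * (X * (4 * (1 / X ^ 3)))"
      unfolding expl X_def[symmetric] using \<eta>k X1 e by (intro mult_left_mono mult_mono) auto
    also have "\<dots> = 4 / X" using X1 by (simp add: power_eq_if)
    also have "\<dots> \<le> 1" using X1 by simp
    finally show "measure ?P (E3 g) \<le> exp (1 - 12 * m * l)" by (simp add: K_def mult_ac)
  qed
  have B3: "measure ?P (\<Union>g\<in>Q. E3 g) \<le> exp (- 5 * l)"
  proof -
    have "measure ?P (\<Union>g\<in>Q. E3 g) \<le> real (card Q) * exp (1 - 12 * m * l)"
      using finQ E3 by (intro measure_UN_le_card I.finite_measure_axioms)
    also have "\<dots> = exp (1 - 6 * (m * l))" unfolding cardQ by (simp flip: exp_add)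
    also have "\<dots> \<le> exp (- 5 * l)" unfolding exp_le_cancel_iff using ml l1 by linarith
    finally show ?thesis .
  qed

  have E2: "E2 g h \<in> sets ?P \<and> measure ?P (E2 g h) \<le> exp (- (14 * m * l))" if g: "g \<in> Q'" and h: "h \<in> Far" for g h
  proof -
    obtain i0 where i0: "i0 < m" "\<rho> < \<bar>\<theta> h i0\<bar>" and hP: "h \<in> {..<m} \<rightarrow>\<^sub>E {..<2 * H + 1}"
      using h by (auto simp: Far_def)
    have k2: "k \<ge> 2" and \<rho>\<theta>: "\<rho> \<le> \<bar>\<theta> h i0\<bar>" and d: "0 \<le> \<delta> / 2" "\<delta> / 2 \<le> 1"
      and U: "k * (\<Sum>i<m. u g i) \<le> 5 / \<beta>"
      using k i0 \<delta> g by (auto simp: Q'_def)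
    note tail = window_sin_squared_tail[where \<theta> = "\<theta> h", OF k2 i0(1) \<rho>0 \<rho>\<theta> k\<rho>' \<theta>_half[OF hP i0(1)] d u0 U]
    have "E2 g h \<in> sets ?P" unfolding E2_def by (rule tail(1))
    moreover have "measure ?P (E2 g h) \<le> exp (L - n * (exp (- (5 / \<beta> + 1)) * (\<delta> / 2) / 2 * ((k * \<rho>)\<^sup>2 / 72)))"
      unfolding E2_def by (rule tail(2))
    moreover
    have "20 * m * l \<le> n * (exp (- (5 / \<beta> + 1)) * (\<delta> / 2) / 2 * ((k * \<rho>)\<^sup>2 / 72))"
    proof -
      have "1 / 4 \<le> exp (- 1 :: real)" using exp_le by (simp add: exp_minus field_simps)
      then have "exp (- (5 / \<beta>)) * (1 / 4) \<le> exp (- (5 / \<beta>)) * exp (- 1)" by (intro mult_left_mono) auto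
      also have "\<dots> = exp (- (5 / \<beta> + 1))" by (simp flip: exp_add)
      finally have "exp (- (5 / \<beta>)) * (1 / 4) \<le> exp (- (5 / \<beta> + 1))" .
      then have "X * ((exp (- (5 / \<beta>)) * (1 / 4)) * (\<delta> / 2) / 2 * ((k * \<rho>)\<^sup>2 / 72))
         \<le> X * (exp (- (5 / \<beta> + 1)) * (\<delta> / 2) / 2 * ((k * \<rho>)\<^sup>2 / 72))"
        using \<delta> X1 by (intro mult_left_mono mult_right_mono divide_right_mono) auto
      moreover have "X * ((exp (- (5 / \<beta>)) * (1 / 4)) * (\<delta> / 2) / 2 * ((k * \<rho>)\<^sup>2 / 72)) = 20 * m * l"
      proof -
        have "X * ((exp (- (5 / \<beta>)) * (1 / 4)) * (\<delta> / 2) / 2 * ((k * \<rho>)\<^sup>2 / 72))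
          = (X * \<delta>) * exp (- (5 / \<beta>)) / (2654208 * real m ^ 4)"
          unfolding k\<rho> by (simp add: power_divide power_mult_distrib flip: power_mult)
        also have "\<dots> = 20 * (real m ^ 5 / real m ^ 4) * l * (exp (5 / \<beta>) * exp (- (5 / \<beta>)))"
          unfolding X\<delta> \<Delta>_def by simp
        also have "\<dots> = 20 * m * l" using m by (simp add: power_eq_if flip: exp_add)
        finally show ?thesis .
      qed
      ultimately show ?thesis unfolding X_def by linarith
    qed
    then have le: "L - n * (exp (- (5 / \<beta> + 1)) * (\<delta> / 2) / 2 * ((k * \<rho>)\<^sup>2 / 72)) \<le> - (14 * m * l)"
      by (simp only: L_def)
    then have "exp (L - n * (exp (- (5 / \<beta> + 1)) * (\<delta> / 2) / 2 * ((k * \<rho>)\<^sup>2 / 72))) \<le> exp (- (14 * m * l))"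
      by (simp only: exp_le_cancel_iff)
    ultimately show ?thesis by (blast intro: order_trans)
  qed
  have B2: "measure ?P (\<Union>(g, h)\<in>Q' \<times> Far. E2 g h) \<le> exp (- 5 * l)"
  proof -
    have "measure ?P (\<Union>w\<in>Q' \<times> Far. case w of (g, h) \<Rightarrow> E2 g h) \<le> real (card (Q' \<times> Far)) * exp (- (14 * m * l))"
      using finQ E2 by (intro measure_UN_le_card I.finite_measure_axioms) auto
    also have "\<dots> \<le> (exp (6 * m * l) * exp (3 * m * l)) * exp (- (14 * m * l))"
      unfolding card_cartesian_product of_nat_mult
      using cardQ' cardFar by (intro mult_right_mono mult_mono) auto
    \<comment> \<open>The exponent 14 against 6 for the grid and 3 for the frequencies leaves
      5.\<close>
    also have "\<dots> = exp (- (5 * (m * l)))" by (simp flip: exp_add)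
    also have "\<dots> \<le> exp (- 5 * l)" using ml by simp
    finally show ?thesis .
  qed
  have S4: "E4 \<in> sets ?P"
    unfolding E4_def using sets_column_tail[of "\<lambda>_ x. \<bar>x\<bar>" m n k "4 * real n"] by simp
  have B4: "measure ?P E4 \<le> exp (- 5 * l)"
  proof -
    have "5 * l \<le> \<Delta> * l" using \<Delta>1 l1 by (intro mult_right_mono) auto
    then have "exp (- X) \<le> exp (- 5 * l)" using \<Delta>l by simp
    then show ?thesis using sum_abs_cost_tail[of m n k] unfolding E4_def X_def by linarith
  qed

  define Bad where "Bad = E4 \<union> (\<Union>g\<in>Q. E1 g) \<union> (\<Union>g\<in>Q. E3 g) \<union> (\<Union>(g, h)\<in>Q' \<times> Far. E2 g h)"
  have sets: "(\<Union>g\<in>Q. E1 g) \<in> sets ?P" "(\<Union>g\<in>Q. E3 g) \<in> sets ?P" "(\<Union>(g, h)\<in>Q' \<times> Far. E2 g h) \<in> sets ?P"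
    using E1 E2 E3 finQ by (auto intro!: sets.finite_UN)
  have Bad_sets: "Bad \<in> sets ?P" unfolding Bad_def using S4 sets by (intro sets.Un)
  have "measure ?P Bad \<le> measure ?P E4 + measure ?P (\<Union>g\<in>Q. E1 g) + measure ?P (\<Union>g\<in>Q. E3 g) + measure ?P (\<Union>(g, h)\<in>Q' \<times> Far. E2 g h)"
    unfolding Bad_def using S4 sets
    by (intro order_trans[OF measure_Un_le] add_mono sets.Un order_refl)
  also have "\<dots> \<le> 4 * exp (- 5 * l)" using B1 B2 B3 B4 by linarith
  \<comment> \<open>The number 4 of failure terms is absorbed into one factor
    \<open>exp l = X\<close>.\<close>
  also have "\<dots> \<le> exp l * exp (- 5 * l)" unfolding expl using X1 by (intro mult_right_mono) auto
  also have "\<dots> \<le> exp (- l)" using l1 by (simp flip: exp_add)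
  also have "\<dots> = 1 / real n" using expl by (simp add: exp_minus X_def divide_inverse)
  finally have Bad: "measure ?P Bad \<le> 1 / real n" .

  have good: "IPGAP m n (\<lambda>i j. real (A (i, j))) b c < 19 * \<Delta>\<^sup>2 * (ln (real n))\<^sup>2 / real n"
    if w: "(A, c) \<in> space ?P" "(A, c) \<notin> Bad" and A: "\<forall>i<m. \<forall>j<n. A (i, j) \<in> {1..k}" for A c
  proof -
    have n1: "n \<ge> 1" and k1: "k \<ge> 1" using X1 k by (simp_all add: X_def)
    have c: "(\<Sum>j<n. \<bar>c j\<bar>) \<le> 4 * real n" using w by (auto simp: Bad_def E4_def)
    \<comment> \<open>The grid reaches beyond \<open>X\<^sup>2 - 1\<close>, whereas
      \<open>5 / \<beta> \<le> \<Delta> \<le> X\<close>.\<close>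
    have G: "5 < k * \<beta> * (\<eta> * (real (n ^ 6) - 1))"
    proof -
      have "5 / \<beta> \<le> X" using \<Delta>\<beta> \<Delta>X by linarith
      then have "5 \<le> \<beta> * X" using \<beta> by (simp add: field_simps)
      moreover have "2 * X \<le> X\<^sup>2" unfolding power2_eq_square using X1 by (intro mult_right_mono) auto
      then have "X < X\<^sup>2 - 1" using X1 by linarith
      then have "\<beta> * X < \<beta> * (X\<^sup>2 - 1)" using \<beta> by simp
      moreover have "X\<^sup>2 - 1 \<le> \<eta> * (real (n ^ 6) - 1)"
      proof -
        have "real (n ^ 6) = X\<^sup>2 * X ^ 4" by (simp add: X_def flip: power_add)
        then have "\<eta> * (real (n ^ 6) - 1) = X\<^sup>2 - 1 / X ^ 4"
          using X1 by (simp only: \<eta>_def) (simp add: diff_divide_distrib power_eq_if)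
        moreover have "1 / X ^ 4 \<le> 1" using X1 by simp
        ultimately show ?thesis by simp
      qed
      then have "1 * \<beta> * (X\<^sup>2 - 1) \<le> k * \<beta> * (\<eta> * (real (n ^ 6) - 1))"
        using k \<beta> X1 by (intro mult_mono) auto
      ultimately show ?thesis by simp
    qed
    obtain g where g: "g \<in> {..<m} \<rightarrow>\<^sub>E {..<n ^ 6}" "k * \<beta> * (\<Sum>i<m. \<eta> * real (g i)) \<le> 5"
      and up: "\<And>i. i < m \<Longrightarrow> smooth_dual m n A b c \<delta> (\<lambda>i. \<eta> * real (g i))
          \<le> smooth_dual m n A b c \<delta> ((\<lambda>i. \<eta> * real (g i))(i := \<eta> * real (g i) + \<eta>))"
      and down: "\<And>i. i < m \<Longrightarrow> 0 < g i \<Longrightarrow> smooth_dual m n A b c \<delta> (\<lambda>i. \<eta> * real (g i))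
          \<le> smooth_dual m n A b c \<delta> ((\<lambda>i. \<eta> * real (g i))(i := \<eta> * real (g i) - \<eta>))"
      using grid_minimizer[where A = A and b = b, OF n1 k1 \<beta> less_imp_le[OF \<delta>(1)] \<delta>(2) \<eta> b(2) c G]
      by blast
    have ug: "(\<lambda>i. \<eta> * real (g i)) = u g" by (simp add: u_def fun_eq_iff)
    have ugi: "\<eta> * real (g i) = u g i" for i by (simp add: u_def)
    note g = g[folded Q_def, unfolded ugi] and up = up[unfolded ug ugi] and down = down[unfolded ug ugi]
    have gQ': "g \<in> Q'" using g \<beta> by (simp add: Q'_def field_simps)
    have card1: "real (card {j. j < n \<and> \<bar>reduced_cost m A c (u g) j\<bar> \<le> 2 * \<delta>}) \<le> 9 * X * \<delta>"
      using w g(1) by (fastforce simp: Bad_def E1_def)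
    have Ak: "A (i, j) \<le> k" if "i < m" "j < n" for i j using A that by auto
    have "IPGAP m n (\<lambda>i j. real (A (i, j))) b c \<le> 2 * \<delta> * card {j. j < n \<and> \<bar>reduced_cost m A c (u g) j\<bar> \<le> 2 * \<delta>}"
    proof (rule IPGAP_le_window[where A = A and b = b and c = c and u = "u g", OF \<delta>(1) \<eta> Ak m k1 \<eta>k\<delta> _ b(1) u0 up])
      show "1 \<le> K" using m by (simp add: K_def)
      show "smooth_dual m n A b c \<delta> (u g) \<le> smooth_dual m n A b c \<delta> ((u g)(i := u g i - \<eta>))"
        if "i < m" "0 < u g i" for i
      proof (rule down[OF that(1)])
        show "0 < g i" using that(2) \<eta> by (simp add: u_def zero_less_mult_iff)
      qed
      show "card {j. j < n \<and> (\<bar>reduced_cost m A c (u g) j - \<delta>\<bar> \<le> \<eta> * k \<or> \<bar>reduced_cost m A c (u g) j + \<delta>\<bar> \<le> \<eta> * k)} \<le> K"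
        using w g(1) by (fastforce simp: Bad_def E3_def)
      show "real n * k / 2 + K * k < real (2 * H + 1)"
      proof -
        have "K \<le> X / 2" using Xm by (simp add: K_def)
        then have "K * k \<le> X / 2 * X" using kX by (intro mult_mono) (auto simp: K_def)
        moreover have "X * k \<le> X * X" using kX X1 by (intro mult_left_mono) auto
        moreover have "real (2 * H + 1) = 2 * (X * X) + 1" by (simp add: H_def X_def power2_eq_square)
        moreover have "0 \<le> X * X" by simp
        ultimately show ?thesis unfolding X_def by linarith
      qed
      have "L / 2 = 3 * m * l" by (simp add: L_def)
      then show "real (2 * H + 1) ^ m \<le> exp (L / 2)" using MM by (simp only:)
    next
      fix h i
      assume "h \<in> {..<m} \<rightarrow>\<^sub>E {..<2 * H + 1}" "i < m"
        "1 / (4 * m * K * k) < \<bar>(real (h i) - real H) / real (2 * H + 1)\<bar>"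
      then have "h \<in> Far" by (auto simp: Far_def \<theta>_def \<rho>_def)
      then have "(A, c) \<notin> E2 g h" using w gQ' by (auto simp: Bad_def)
      then have "L \<le> (\<Sum>j | j < n \<and> \<bar>reduced_cost m A c (u g) j\<bar> \<le> \<delta> / 2. (sin (pi * (\<Sum>i<m. \<theta> h i * real (A (i, j)))))\<^sup>2)"
        using w(1) by (simp add: E2_def)
      then show "L \<le> (\<Sum>j | j < n \<and> \<bar>reduced_cost m A c (u g) j\<bar> \<le> \<delta> / 2.
          (sin (pi * (\<Sum>i<m. (real (h i) - real H) / real (2 * H + 1) * A (i, j))))\<^sup>2)"
        by (simp add: \<theta>_def)
    qed
    also have "\<dots> \<le> 2 * \<delta> * (9 * X * \<delta>)" using card1 \<delta> by (intro mult_left_mono) auto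
    also have "\<dots> = 18 * (\<Delta>\<^sup>2 * l\<^sup>2 / X)" using X1 by (simp add: \<delta>_def power2_eq_square)
    \<comment> \<open>Rounding 18 up to 19 makes the inequality strict, as the tail event includes
      equality.\<close>
    also have "\<dots> < 19 * (\<Delta>\<^sup>2 * l\<^sup>2 / X)" using \<Delta>1 l1 X1 by (intro mult_strict_right_mono divide_pos_pos mult_pos_pos) auto
    finally show ?thesis by (simp add: l_def X_def)
  qed
  have "measure ?P {(A, c) \<in> space ?P. 19 * \<Delta>\<^sup>2 * (ln (real n))\<^sup>2 / real n \<le> IPGAP m n (\<lambda>i j. real (A (i, j))) b c} \<le> measure ?P Bad"
  \<comment> \<open>The inclusion in \<open>Bad\<close> holds off the null set on which some entry
    lies outside \<open>{1..k}\<close>.\<close>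
  proof (rule I.finite_measure_mono_AE[OF _ Bad_sets])
    have "k \<ge> 1" using k by simp
    from AE_instance_law[OF this, of m n]
    show "AE w in ?P. w \<in> {(A, c) \<in> space ?P. 19 * \<Delta>\<^sup>2 * (ln (real n))\<^sup>2 / real n \<le> IPGAP m n (\<lambda>i j. real (A (i, j))) b c} \<longrightarrow> w \<in> Bad"
      by (rule AE_mp) (intro AE_I2 impI, use good in \<open>force simp: not_le[symmetric]\<close>)
  qed
  then show ?thesis using Bad by linarith
qed

theorem theorem3:
  "\<exists>(C::real) (P1::real poly poly) (P2::real poly) (P3::real poly).
     C > 0 \<and>
     (\<forall>m\<ge>1. \<forall>k\<ge>1. poly2 P1 (real m) (real k) \<ge> 1) \<and>
     (\<forall>m\<ge>1. poly P2 (real m) \<ge> 1) \<and>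
     (\<forall>m\<ge>1. poly P3 (real m) \<ge> 1) \<and>
     (\<forall>(m::nat) (k::nat) (n::nat) (\<beta>::real) (b::nat \<Rightarrow> real).
        m \<ge> 1 \<longrightarrow> k \<ge> 3 \<longrightarrow> 0 < \<beta> \<longrightarrow> \<beta> < 1/4 \<longrightarrow>
        real n \<ge> poly2 P1 (real m) (real k) * exp (C / \<beta>) \<longrightarrow>
        b \<in> {..<m} \<rightarrow>\<^sub>E ({real k * real n * \<beta> <..< real k * real n * (1/2 - \<beta>)} \<inter> \<int>) \<longrightarrow>
        measure (instance_law m n k)
          {(A, c) \<in> space (instance_law m n k).
             IPGAP m n (\<lambda>i j. real (A (i, j))) b c
               \<ge> exp (C / \<beta>) * poly P2 (real m) * (ln (real n))\<^sup>2 / real n}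
          \<le> real n powr (- poly P3 (real m)))"
proof -
  define D :: real where "D = 53084160"
  \<comment> \<open>Squaring \<Delta> doubles its exponents: \<open>m ^ 5\<close> becomes
    \<open>m ^ 10\<close>, and \<open>exp (5 / \<beta>)\<close> gives the witness 10 for
    \<open>C\<close>. The inner monomial is the power of \<open>m\<close>, the outer one the power
    of \<open>k\<close>.\<close>
  let ?P1 = "monom (monom (4 * D\<^sup>2) 10) 1 :: real poly poly"
  let ?P2 = "monom (19 * D\<^sup>2) 10 :: real poly"
  have ge1: "1 \<le> c * x" if "1 \<le> c" "1 \<le> x" for c x :: real
    using mult_mono[of 1 c 1 x] that by simp
  have pow1: "1 \<le> real m ^ 10" if "1 \<le> m" for m using that by simp
  show ?thesis
  proof (rule exI[of _ "10::real"], rule exI[of _ ?P1], rule exI[of _ ?P2], rule exI[of _ "1::real poly"], intro conjI allI impI)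
    fix m k n :: nat and \<beta> :: real and b :: "nat \<Rightarrow> real"
    assume m: "m \<ge> 1" and k: "k \<ge> 3" and \<beta>: "0 < \<beta>"
      and n: "poly2 ?P1 (real m) (real k) * exp (10 / \<beta>) \<le> real n"
      and b: "b \<in> {..<m} \<rightarrow>\<^sub>E ({real k * real n * \<beta> <..< real k * real n * (1/2 - \<beta>)} \<inter> \<int>)"
    define \<Delta> where "\<Delta> = 53084160 * real m ^ 5 * exp (5 / \<beta>)"
    have \<Delta>: "\<Delta>\<^sup>2 = D\<^sup>2 * real m ^ 10 * exp (10 / \<beta>)"
      by (simp add: \<Delta>_def D_def power_mult_distrib flip: power_mult exp_of_nat_mult)
    have n4: "4 * \<Delta>\<^sup>2 * real k \<le> real n"
      using n by (simp add: poly2_monom \<Delta> mult_ac)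
    have "0 < \<Delta>\<^sup>2" using m by (simp add: \<Delta>_def)
    then have "0 < 4 * \<Delta>\<^sup>2 * real k" using k by simp
    then have "real n > 0" using n4 by linarith
    then have n_powr: "real n powr (- poly 1 (real m)) = 1 / real n"
      by (simp add: powr_minus divide_inverse)
    have bound: "exp (10 / \<beta>) * poly ?P2 (real m) * (ln (real n))\<^sup>2 / real n = 19 * \<Delta>\<^sup>2 * (ln (real n))\<^sup>2 / real n"
      by (simp add: poly_monom \<Delta> mult_ac)
    have b': "b i \<in> \<int>" "real k * real n * \<beta> \<le> b i" if "i < m" for i
      using b that by (force simp: PiE_iff)+
    show "measure (instance_law m n k)
          {(A, c) \<in> space (instance_law m n k).
             IPGAP m n (\<lambda>i j. real (A (i, j))) b c
               \<ge> exp (10 / \<beta>) * poly ?P2 (real m) * (ln (real n))\<^sup>2 / real n}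
          \<le> real n powr (- poly 1 (real m))"
      unfolding n_powr bound
      using IPGAP_tail[OF m k \<beta> n4[unfolded \<Delta>_def] b'] by (simp add: \<Delta>_def)
  qed (use ge1 pow1 in \<open>auto simp: poly2_monom poly_monom D_def intro!: ge1\<close>)
qed

end
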